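(* Let $\Delta t>0$ and $n\ge0$. Given $u_h^{n-1},u_h^n\in V_h$ and $U_h^n\in V_h$, put $u_h^{n,*}=\frac32u_h^n-\frac12u_h^{n-1}$ and consider the scheme: find $(u_h^{n+1},U_h^{n+1})\in V_h\times V_h$ such that, with $u_h^{n+1/2}=\frac12(u_h^n+u_h^{n+1})$ and $U_h^{n+1/2}=\frac12(U_h^n+U_h^{n+1})$, for all $\phi,\psi\in V_h$ $$\left(\frac{u_h^{n+1/2}-u_h^n}{\frac12\Delta t},\phi\right)=-A(\epsilon^2;u_h^{n+1/2},\phi)-\left(H(u_h^{n,*})U_h^{n+1/2},\phi\right),$$ $$\left(\frac{U_h^{n+1/2}-U_h^n}{\frac12\Delta t},\psi\right)=\left(\frac12H(u_h^{n,*})\frac{u_h^{n+1/2}-u_h^n}{\frac12\Delta t},\psi\right).$$ Then for any $\Delta t>0$ the scheme admits a unique solution $u_h^{n+1}\in V_h$, $U_h^{n+1}\in V_h$, and it satisfies the energy dissipation law $$E(u_h^{n+1},U_h^{n+1})=E(u_h^n,U_h^n)-\frac1{\Delta t}\|u_h^{n+1}-u_h^n\|^2.$$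
   Context: $\Omega\subset\mathbb{R}^d$ ($d=2,3$) is a bounded domain and $\epsilon>0$ is a constant. $\mathcal T$ is a quasi-uniform triangulation $\Omega=\cup_{i=1}^N T_i$, and $V_h=\{v\in C^0(\Omega)\cap H^1(\Omega): v|_{T_i}\in P_k\ \forall T_i\in\mathcal T\}$, where $P_k$ is the space of polynomials of degree at most $k$ ($k\ge1$ fixed). $C^0(\Omega)$ denotes functions continuous on $\overline\Omega$. $(\cdot,\cdot)$ and $\|\cdot\|$ are the $L^2(\Omega)$ inner product and norm. For a coefficient $a(x)$, $A(a;q,v)=\int_\Omega a(x)\nabla q\cdot\nabla v\,dx$. The potential $F$ is a $C^1$ function on an interval $I\subseteq\mathbb{R}$ (e.g. $F(u)=\frac14(u^2-1)^2$ with $I=\mathbb{R}$, or the logarithmic Flory–Huggins potential with $I=(0,1)$). The constant $B\ge0$ is such that $F+B>0$, and $H(w)=F'(w)/\sqrt{F(w)+B}$. It is a standing assumption that all functions at which $F,F',H$ are evaluated take values (on $\overline\Omega$) where these are defined and $F+B>0$. The energy is $E(v,V)=\frac12A(\epsilon^2;v,v)+\int_\Omega V^2\,dx-B|\Omega|$. *)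

theory Defs
  imports "HOL-Analysis.Analysis"
begin

definition domain :: "'a::euclidean_space set \<Rightarrow> bool" where
  "domain \<Omega> \<longleftrightarrow> open \<Omega> \<and> connected \<Omega> \<and> \<Omega> \<noteq> {}"


section \<open>Square-integrable functions and weak gradients\<close>

definition L2 :: "'a::euclidean_space set \<Rightarrow> ('a \<Rightarrow> real) \<Rightarrow> bool" where
  "L2 \<Omega> f \<longleftrightarrow>
     set_borel_measurable lebesgue \<Omega> f \<and> set_integrable lebesgue \<Omega> (\<lambda>x. (f x)\<^sup>2)"

definition L2_inner :: "'a::euclidean_space set \<Rightarrow> ('a \<Rightarrow> real) \<Rightarrow> ('a \<Rightarrow> real) \<Rightarrow> real" where
  "L2_inner \<Omega> f g = (LINT x:\<Omega>|lebesgue. f x * g x)"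

definition L2_norm :: "'a::euclidean_space set \<Rightarrow> ('a \<Rightarrow> real) \<Rightarrow> real" where
  "L2_norm \<Omega> f = sqrt (L2_inner \<Omega> f f)"

text \<open>For \<open>i\<close> in the standard basis, \<open>frechet_derivative f (at x) i\<close> is the partial derivative
  of \<open>f\<close> in direction \<open>i\<close>.\<close>

fun Cn :: "nat \<Rightarrow> ('a::euclidean_space \<Rightarrow> real) \<Rightarrow> bool" where
  "Cn 0 f \<longleftrightarrow> continuous_on UNIV f"
| "Cn (Suc n) f \<longleftrightarrow>
     f differentiable_on UNIV \<and> (\<forall>i\<in>Basis. Cn n (\<lambda>x. frechet_derivative f (at x) i))"

definition test_function :: "'a::euclidean_space set \<Rightarrow> ('a \<Rightarrow> real) \<Rightarrow> bool" where
  "test_function \<Omega> \<phi> \<longleftrightarrow>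
     (\<forall>n. Cn n \<phi>) \<and> compact (closure {x. \<phi> x \<noteq> 0}) \<and> closure {x. \<phi> x \<noteq> 0} \<subseteq> \<Omega>"

definition has_weak_gradient :: "'a::euclidean_space set \<Rightarrow> ('a \<Rightarrow> real) \<Rightarrow> ('a \<Rightarrow> 'a) \<Rightarrow> bool" where
  "has_weak_gradient \<Omega> v g \<longleftrightarrow>
     (\<forall>\<phi>. test_function \<Omega> \<phi> \<longrightarrow> (\<forall>i\<in>Basis.
        (LINT x:\<Omega>|lebesgue. v x * frechet_derivative \<phi> (at x) i) =
        - (LINT x:\<Omega>|lebesgue. (g x \<bullet> i) * \<phi> x)))"

definition L2_weak_gradient :: "'a::euclidean_space set \<Rightarrow> ('a \<Rightarrow> real) \<Rightarrow> ('a \<Rightarrow> 'a) \<Rightarrow> bool" where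
  "L2_weak_gradient \<Omega> v g \<longleftrightarrow> (\<forall>i\<in>Basis. L2 \<Omega> (\<lambda>x. g x \<bullet> i)) \<and> has_weak_gradient \<Omega> v g"

definition H1 :: "'a::euclidean_space set \<Rightarrow> ('a \<Rightarrow> real) \<Rightarrow> bool" where
  "H1 \<Omega> v \<longleftrightarrow> L2 \<Omega> v \<and> (\<exists>g. L2_weak_gradient \<Omega> v g)"

text \<open>The weak gradient is determined only almost everywhere in \<open>\<Omega>\<close>; this picks a representative.
  It is used only under integrals over \<open>\<Omega>\<close>, where the choice is irrelevant.\<close>

definition weak_gradient :: "'a::euclidean_space set \<Rightarrow> ('a \<Rightarrow> real) \<Rightarrow> 'a \<Rightarrow> 'a" where
  "weak_gradient \<Omega> v = (SOME g. L2_weak_gradient \<Omega> v g)"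


section \<open>The finite element space\<close>

text \<open>Brenner--Scott form of quasi-uniformity: every element contains a ball whose radius is
  comparable to the global mesh size.\<close>

definition quasi_uniform :: "real \<Rightarrow> 'a::euclidean_space set set \<Rightarrow> bool" where
  "quasi_uniform \<rho> \<T> \<longleftrightarrow>
     \<rho> > 0 \<and> (\<forall>T\<in>\<T>. \<exists>z. cball z (\<rho> * Max (diameter ` \<T>)) \<subseteq> T)"

text \<open>The elements are closed simplices, so \<open>\<Omega> = \<Union>T\<^sub>i\<close> is read up to the boundary.\<close>

definition triangulation_of :: "'a::euclidean_space set \<Rightarrow> 'a set set \<Rightarrow> bool" where
  "triangulation_of \<Omega> \<T> \<longleftrightarrow>
     triangulation \<T> \<and> (\<forall>T\<in>\<T>. int DIM('a) simplex T) \<and> closure \<Omega> = \<Union>\<T>"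

definition poly_deg_le :: "nat \<Rightarrow> ('a::euclidean_space \<Rightarrow> real) set" where
  "poly_deg_le k =
     {p. \<exists>c. \<forall>x. p x =
        (\<Sum>\<alpha> \<in> {\<alpha> \<in> Basis \<rightarrow>\<^sub>E {..k}. (\<Sum>i\<in>Basis. \<alpha> i) \<le> k}. c \<alpha> * (\<Prod>i\<in>Basis. (x \<bullet> i) ^ \<alpha> i))}"

text \<open>Functions on the closure of \<open>\<Omega>\<close> are represented by total functions that vanish outside it,
  so that equality of elements of \<open>V\<^sub>h\<close> is equality of functions on the closure and the pointwise
  operations give the vector space structure.\<close>

definition fe_space :: "'a::euclidean_space set \<Rightarrow> 'a set set \<Rightarrow> nat \<Rightarrow> ('a \<Rightarrow> real) set" where
  "fe_space \<Omega> \<T> k =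
     {v. continuous_on (closure \<Omega>) v \<and> H1 \<Omega> v \<and>
         (\<forall>T\<in>\<T>. \<exists>p\<in>poly_deg_le k. \<forall>x\<in>T. v x = p x) \<and>
         (\<forall>x. x \<notin> closure \<Omega> \<longrightarrow> v x = 0)}"


section \<open>The scheme and the energy\<close>

definition A_form :: "'a::euclidean_space set \<Rightarrow> ('a \<Rightarrow> real) \<Rightarrow> ('a \<Rightarrow> real) \<Rightarrow> ('a \<Rightarrow> real) \<Rightarrow> real" where
  "A_form \<Omega> a q v = (LINT x:\<Omega>|lebesgue. a x * (weak_gradient \<Omega> q x \<bullet> weak_gradient \<Omega> v x))"

text \<open>The derivative is one-sided at endpoints belonging to \<open>I\<close>; the nonempty interior makes \<open>F'\<close>
  unique on \<open>I\<close>.\<close>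

definition C1_potential :: "real set \<Rightarrow> (real \<Rightarrow> real) \<Rightarrow> (real \<Rightarrow> real) \<Rightarrow> bool" where
  "C1_potential I F F' \<longleftrightarrow>
     is_interval I \<and> interior I \<noteq> {} \<and>
     (\<forall>w\<in>I. (F has_real_derivative F' w) (at w within I)) \<and> continuous_on I F'"

definition H_fun :: "(real \<Rightarrow> real) \<Rightarrow> (real \<Rightarrow> real) \<Rightarrow> real \<Rightarrow> real \<Rightarrow> real" where
  "H_fun F F' B w = F' w / sqrt (F w + B)"

definition energy ::
  "'a::euclidean_space set \<Rightarrow> real \<Rightarrow> real \<Rightarrow> ('a \<Rightarrow> real) \<Rightarrow> ('a \<Rightarrow> real) \<Rightarrow> real" where
  "energy \<Omega> \<epsilon> B v V =
     1/2 * A_form \<Omega> (\<lambda>_. \<epsilon>\<^sup>2) v v + (LINT x:\<Omega>|lebesgue. (V x)\<^sup>2) - B * measure lebesgue \<Omega>"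

definition extrapolation :: "('a \<Rightarrow> real) \<Rightarrow> ('a \<Rightarrow> real) \<Rightarrow> 'a \<Rightarrow> real" where
  "extrapolation u_prev u_n = (\<lambda>x. 3/2 * u_n x - 1/2 * u_prev x)"

definition midpoint_fun :: "('a \<Rightarrow> real) \<Rightarrow> ('a \<Rightarrow> real) \<Rightarrow> 'a \<Rightarrow> real" where
  "midpoint_fun v w = (\<lambda>x. 1/2 * (v x + w x))"

text \<open>\<open>h\<close> stands for \<open>H(u\<^sub>h\<^sup>n\<^sup>,\<^sup>*)\<close>, and \<open>(u_n, U_n)\<close>, \<open>(u_new, U_new)\<close> for the iterates at the
  old and the new time level.\<close>

definition scheme_solution ::
  "('a::euclidean_space \<Rightarrow> real) set \<Rightarrow> 'a set \<Rightarrow> real \<Rightarrow> real \<Rightarrow> ('a \<Rightarrow> real) \<Rightarrow>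
   ('a \<Rightarrow> real) \<Rightarrow> ('a \<Rightarrow> real) \<Rightarrow> ('a \<Rightarrow> real) \<Rightarrow> ('a \<Rightarrow> real) \<Rightarrow> bool" where
  "scheme_solution Vh \<Omega> \<epsilon> \<Delta>t h u_n U_n u_new U_new \<longleftrightarrow>
     u_new \<in> Vh \<and> U_new \<in> Vh \<and>
     (let u_mid = midpoint_fun u_n u_new; U_mid = midpoint_fun U_n U_new in
       (\<forall>\<phi>\<in>Vh. L2_inner \<Omega> (\<lambda>x. (u_mid x - u_n x) / (1/2 * \<Delta>t)) \<phi> =
          - A_form \<Omega> (\<lambda>_. \<epsilon>\<^sup>2) u_mid \<phi> - L2_inner \<Omega> (\<lambda>x. h x * U_mid x) \<phi>) \<and>
       (\<forall>\<psi>\<in>Vh. L2_inner \<Omega> (\<lambda>x. (U_mid x - U_n x) / (1/2 * \<Delta>t)) \<psi> =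
          L2_inner \<Omega> (\<lambda>x. 1/2 * h x * ((u_mid x - u_n x) / (1/2 * \<Delta>t))) \<psi>))"

end

theory Submission
  imports Defs "HOL-Library.Function_Algebras"
begin

text \<open>In terms of the half increments \<open>w = (u - u\<^sub>n) / 2\<close> and \<open>Z = (U - U\<^sub>n) / 2\<close> one step of the scheme
  is a linear problem on \<open>V\<^sub>h \<times> V\<^sub>h\<close>. After multiplying the second equation by \<open>\<Delta>t\<close> and adding it to
  the first, the left-hand side tested with \<open>(\<phi>, \<psi>)\<close> is
  \<open>2/\<Delta>t (w, \<phi>) + A(\<epsilon>\<^sup>2; w, \<phi>) + (h Z, \<phi>) + 2 (Z, \<psi>) - (h w, \<psi>)\<close>. At \<open>(\<phi>, \<psi>) = (w, Z)\<close> the two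
  coupling terms cancel, so the form is positive definite for every \<open>\<Delta>t > 0\<close>, and on a finite
  dimensional space a definite bilinear form represents every linear functional exactly once.
  This gives existence and uniqueness (\<open>galerkin_unique_solution\<close>, \<open>step_form_definite\<close>). The same
  cancellation, now with the midpoint value \<open>U\<^sub>n + Z\<close> as test function in the second equation,
  gives the energy law (\<open>energy_dissipation\<close>).

  Most of the work lies in two facts that this argument takes for granted. The form \<open>A\<close> is defined
  through an arbitrary choice of weak gradient, so its bilinearity rests on the uniqueness almost
  everywhere of weak gradients, which is the fundamental lemma of the calculus of variations
  (\<open>fundamental_lemma_variations\<close>). It is proved by approximating indicators of boxes by products of
  one-dimensional smooth functions built from \<open>exp (-1/t)\<close>. Finite dimensionality of \<open>V\<^sub>h\<close>
  follows because each of its elements is a combination of monomials cut off to single mesh cells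
  (\<open>fe_space_finite_dimensional\<close>).\<close>


section \<open>Smooth bump functions on boxes\<close>

lemma Cn_SucD: "Cn (Suc n) f \<Longrightarrow> Cn n f"
proof (induction n arbitrary: f)
  case 0
  then show ?case by (simp add: differentiable_imp_continuous_on)
next
  case (Suc n)
  then show ?case by (metis Cn.simps(2))
qed

lemma Cn_SucI:
  assumes "\<And>x. (f has_derivative D x) (at x)" "\<And>i. i \<in> Basis \<Longrightarrow> Cn n (\<lambda>x. D x i)"
  shows "Cn (Suc n) f"
proof -
  have "frechet_derivative f (at x) = D x" for x
    using frechet_derivative_at[OF assms(1)] by simp
  moreover have "f differentiable_on UNIV"
    using assms(1) unfolding differentiable_on_def differentiable_def by auto
  ultimately show ?thesis using assms(2) by simp
qed

lemma Cn_SucE: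
  assumes "Cn (Suc n) f"
  shows "(f has_derivative frechet_derivative f (at x)) (at x)"
    and "i \<in> Basis \<Longrightarrow> Cn n (\<lambda>x. frechet_derivative f (at x) i)"
  using assms by (auto simp: differentiable_on_def frechet_derivative_works)

lemma Cn_const: "Cn n (\<lambda>x. c)"
proof (induction n arbitrary: c)
  case (Suc n)
  show ?case by (rule Cn_SucI[where D = "\<lambda>x h. 0"]) (auto intro!: derivative_eq_intros Suc)
qed simp

lemma Cn_add: "Cn n f \<Longrightarrow> Cn n g \<Longrightarrow> Cn n (\<lambda>x. f x + g x)"
proof (induction n arbitrary: f g)
  case 0
  then show ?case by (auto intro: continuous_intros)
next
  case (Suc n)
  show ?case
  proof (rule Cn_SucI)
    show "((\<lambda>x. f x + g x) has_derivative
      (\<lambda>h. frechet_derivative f (at x) h + frechet_derivative g (at x) h)) (at x)" for x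
      using Suc.prems by (intro has_derivative_add Cn_SucE(1))
  qed (intro Suc.IH Cn_SucE(2) Suc.prems)
qed

lemma Cn_mult: "Cn n f \<Longrightarrow> Cn n g \<Longrightarrow> Cn n (\<lambda>x. f x * g x)"
proof (induction n arbitrary: f g)
  case 0
  then show ?case by (auto intro: continuous_intros)
next
  case (Suc n)
  show ?case
  proof (rule Cn_SucI)
    show "((\<lambda>x. f x * g x) has_derivative
      (\<lambda>h. f x * frechet_derivative g (at x) h + frechet_derivative f (at x) h * g x)) (at x)" for x
      using Suc.prems by (intro has_derivative_mult Cn_SucE(1))
  qed (intro Cn_add Suc.IH Cn_SucE(2) Suc.prems Cn_SucD)
qed

lemma Cn_prod: "(\<And>i. i \<in> A \<Longrightarrow> Cn n (f i)) \<Longrightarrow> Cn n (\<lambda>x. \<Prod>i\<in>A. f i x)"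
  by (induction A rule: infinite_finite_induct) (simp_all add: Cn_const Cn_mult)

text \<open>For \<open>k = 0\<close> this is the classical smooth function that vanishes to infinite order at 0. The
  powers of \<open>1/t\<close> are included because the derivative of each member of the family is a combination
  of two later members, so that smoothness follows by induction without naming higher derivatives.\<close>
definition flat :: "nat \<Rightarrow> real \<Rightarrow> real" where
  "flat k t = (if t > 0 then (1 / t) ^ k * exp (- (1 / t)) else 0)"

text \<open>Exponential decay beats every power of \<open>1/t\<close>; this also yields the derivative at 0, since the
  difference quotient of \<open>flat k\<close> there is \<open>flat (k + 1)\<close>.\<close>
lemma flat_tendsto_0: "(flat k \<longlongrightarrow> 0) (at 0)"
proof -
  have "((\<lambda>t::real. (inverse t) ^ k / exp (inverse t)) \<longlongrightarrow> 0) (at_right 0)"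
    by (rule filterlim_compose[OF tendsto_power_div_exp_0 filterlim_inverse_at_top_right])
  then have "(flat k \<longlongrightarrow> 0) (at_right 0)"
    by (rule tendsto_cong[THEN iffD1, rotated])
      (auto simp: flat_def eventually_at_right_less exp_minus field_simps eventually_at_filter
            intro!: always_eventually)
  moreover have "(flat k \<longlongrightarrow> 0) (at_left 0)"
    by (rule tendsto_eventually) (auto simp: flat_def eventually_at_filter)
  ultimately show ?thesis by (simp add: filterlim_split_at_real)
qed

lemma flat_has_derivative:
  "(flat k has_real_derivative flat (k + 2) t - real k * flat (k + 1) t) (at t)"
proof -
  consider "t > 0" | "t < 0" | "t = 0" by linarith
  then show ?thesis
  proof cases
    case 1
    have pow: "((\<lambda>t. (1 / t) ^ j) has_real_derivative - (real j * (1 / t) ^ (j + 1))) (at t)" for j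
    proof (induction j)
      case (Suc j)
      have "((\<lambda>t. 1 / t) has_real_derivative - (1 / t) * (1 / t)) (at t)"
        using 1 by (auto intro!: derivative_eq_intros)
      from DERIV_mult[OF this Suc] show ?case by (simp add: algebra_simps add_divide_distrib)
    qed simp
    have "((\<lambda>t. exp (- (1 / t))) has_real_derivative exp (- (1 / t)) * ((1 / t) * (1 / t))) (at t)"
      using 1 by (auto intro!: derivative_eq_intros)
    from DERIV_mult[OF pow this]
    have "((\<lambda>t. (1 / t) ^ k * exp (- (1 / t))) has_real_derivative
        flat (k + 2) t - real k * flat (k + 1) t) (at t)"
      using 1 by (simp add: flat_def algebra_simps)
    then show ?thesis
      by (rule has_field_derivative_transform_within_open[where S = "{0<..}"])
        (use 1 in \<open>auto simp: flat_def\<close>)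
  next
    case 2
    have "((\<lambda>t. 0) has_real_derivative flat (k + 2) t - real k * flat (k + 1) t) (at t)"
      using 2 by (simp add: flat_def)
    then show ?thesis
      by (rule has_field_derivative_transform_within_open[where S = "{..<0}"])
        (use 2 in \<open>auto simp: flat_def\<close>)
  next
    case 3
    have "((\<lambda>h. (flat k (0 + h) - flat k 0) / h) \<longlongrightarrow> 0) (at 0)"
      by (rule tendsto_cong[THEN iffD1, rotated, OF flat_tendsto_0[of "Suc k"]])
        (auto simp: flat_def)
    with 3 show ?thesis by (simp add: DERIV_def flat_def)
  qed
qed

lemma Cn_flat_affine: "Cn n (\<lambda>x. flat k (x \<bullet> e + d))"
proof (induction n arbitrary: k)
  case 0
  have "isCont (flat k) t" for t by (rule DERIV_isCont[OF flat_has_derivative])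
  then have "continuous_on UNIV (flat k)" by (simp add: continuous_on_eq_continuous_at)
  then show ?case
    by (auto intro!: continuous_on_compose2[of UNIV "flat k"] continuous_intros)
next
  case (Suc n)
  show ?case
  proof (rule Cn_SucI)
    fix x :: 'a
    have "((\<lambda>x. x \<bullet> e + d) has_derivative (\<lambda>h. h \<bullet> e)) (at x)"
      by (auto intro!: derivative_eq_intros)
    from has_derivative_compose[OF this flat_has_derivative[unfolded has_field_derivative_def]]
    show "((\<lambda>x. flat k (x \<bullet> e + d)) has_derivative
       (\<lambda>h. (flat (k + 2) (x \<bullet> e + d) + (- real k) * flat (k + 1) (x \<bullet> e + d)) * (h \<bullet> e))) (at x)"
      by simp
  qed (intro Cn_mult Cn_add Cn_const Suc.IH)
qed

text \<open>The factor \<open>m\<close> steepens the profile: as \<open>m\<close> grows, each factor tends to 1 at points strictly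
  inside the box, while the support stays in the closed box.\<close>
definition box_bump :: "'a::euclidean_space \<Rightarrow> 'a \<Rightarrow> nat \<Rightarrow> 'a \<Rightarrow> real" where
  "box_bump a b m x =
     (\<Prod>i\<in>Basis. flat 0 (real m * (x \<bullet> i - a \<bullet> i)) * flat 0 (real m * (b \<bullet> i - x \<bullet> i)))"

lemma Cn_box_bump: "Cn n (box_bump a b m)"
proof -
  have "Cn n (\<lambda>x. \<Prod>i\<in>Basis. flat 0 (x \<bullet> (real m *\<^sub>R i) + (- real m * (a \<bullet> i)))
              * flat 0 (x \<bullet> (- real m *\<^sub>R i) + real m * (b \<bullet> i)))"
    by (intro Cn_prod Cn_mult Cn_flat_affine)
  then show ?thesis by (simp add: box_bump_def[abs_def] algebra_simps)
qed

lemma flat_0_bounds: "0 \<le> flat 0 t" "flat 0 t \<le> 1"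
  by (auto simp: flat_def)

lemma box_bump_bounds: "0 \<le> box_bump a b m x" "box_bump a b m x \<le> 1"
  unfolding box_bump_def
  by (auto intro!: prod_nonneg prod_le_1 mult_nonneg_nonneg mult_le_one flat_0_bounds)

lemma box_bump_outside:
  assumes "x \<notin> box a b" shows "box_bump a b m x = 0"
proof -
  from assms obtain i where "i \<in> Basis" "x \<bullet> i \<le> a \<bullet> i \<or> b \<bullet> i \<le> x \<bullet> i"
    by (auto simp: mem_box not_less)
  then have "flat 0 (real m * (x \<bullet> i - a \<bullet> i)) * flat 0 (real m * (b \<bullet> i - x \<bullet> i)) = 0"
    by (auto simp: flat_def zero_less_mult_iff)
  with \<open>i \<in> Basis\<close> show ?thesis unfolding box_bump_def by (intro prod_zero) auto
qed

lemma flat_0_tendsto_1: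
  assumes "t > 0" shows "(\<lambda>m. flat 0 (real m * t)) \<longlonglongrightarrow> 1"
proof -
  have "(\<lambda>m. exp (- (inverse (real m) / t))) \<longlonglongrightarrow> exp (- (0 / t))"
    by (intro tendsto_intros lim_inverse_n) (use assms in auto)
  moreover have "\<forall>\<^sub>F m in sequentially. exp (- (inverse (real m) / t)) = flat 0 (real m * t)"
    using eventually_gt_at_top[of 0]
    by eventually_elim (use assms in \<open>simp add: flat_def field_simps\<close>)
  ultimately show ?thesis by (simp add: tendsto_cong)
qed

lemma box_bump_tendsto:
  fixes a b x :: "'a::euclidean_space"
  shows "(\<lambda>m. box_bump a b m x) \<longlonglongrightarrow> indicator (box a b) x"
proof (cases "x \<in> box a b")
  case True
  have "(\<lambda>m. box_bump a b m x) \<longlonglongrightarrow> (\<Prod>i\<in>(Basis :: 'a set). 1 * 1)"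
    unfolding box_bump_def
    using True by (intro tendsto_prod tendsto_mult flat_0_tendsto_1) (auto simp: mem_box)
  with True show ?thesis by simp
qed (simp add: box_bump_outside)

lemma test_function_box_bump:
  assumes "cbox a b \<subseteq> \<Omega>" shows "test_function \<Omega> (box_bump a b m)"
proof -
  have supp: "{x. box_bump a b m x \<noteq> 0} \<subseteq> cbox a b"
    using box_bump_outside box_subset_cbox by blast
  then have sub: "closure {x. box_bump a b m x \<noteq> 0} \<subseteq> cbox a b"
    by (intro closure_minimal closed_cbox)
  then have "compact (closure {x. box_bump a b m x \<noteq> 0})"
    using supp by (auto simp: compact_eq_bounded_closed intro: bounded_subset[OF bounded_cbox])
  with sub show ?thesis
    unfolding test_function_def using assms Cn_box_bump by blast
qed

section \<open>The fundamental lemma of the calculus of variations\<close>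

text \<open>Open boxes form an intersection-stable generator of the Borel sets, so Dynkin's theorem
  transfers vanishing integrals from boxes to all Borel sets. The argument runs for a Borel
  representative of \<open>f\<close>, because Lebesgue sets are not generated by boxes.\<close>
lemma AE_zero_if_box_integrals_zero:
  fixes f :: "'a::euclidean_space \<Rightarrow> real"
  assumes f: "integrable lebesgue f" and box: "\<And>a b. (LINT x:box a b|lebesgue. f x) = 0"
  shows "AE x in lebesgue. f x = 0"
proof -
  obtain f' where f': "f' \<in> borel_measurable lborel" and eq: "AE x in lborel. f x = f' x"
    using completion_ex_borel_measurable_real[OF borel_measurable_integrable[OF f]]
    by (elim bexE)
  have eq': "AE x in lebesgue. f x = f' x" using eq by (rule AE_completion)
  have int': "integrable lborel f'"
  proof -
    have "f' \<in> borel_measurable lebesgue" using f' by (rule measurable_completion)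
    then have "integrable lebesgue f'" using integrable_cong_AE_imp[OF f _ eq'] by blast
    with f' show ?thesis by (simp add: integrable_completion)
  qed
  have set_int: "set_integrable lborel A f'" if "A \<in> sets borel" for A
    using that int' unfolding set_integrable_def by (intro integrable_mult_indicator) auto
  have box': "(LINT x:box a b|lborel. f' x) = 0" for a b :: 'a
  proof -
    have "(LINT x:box a b|lborel. f' x) = (LINT x:box a b|lebesgue. f' x)"
      unfolding set_lebesgue_integral_def using f' by (subst integral_completion) auto
    also have "\<dots> = (LINT x:box a b|lebesgue. f x)"
      using eq' f f' by (intro set_lebesgue_integral_cong_AE) (auto intro: measurable_completion)
    finally show ?thesis using box by simp
  qed
  \<comment> \<open>The whole space is an increasing union of boxes; this is needed for complements.\<close>
  have UNIV0: "(LINT x:UNIV|lborel. f' x) = 0"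
  proof -
    have "(\<lambda>n. LINT x:box (- real n *\<^sub>R One) (real n *\<^sub>R One)|lborel. f' x) \<longlonglongrightarrow>
        (LINT x:(\<Union>n::nat. box (- real n *\<^sub>R One) (real n *\<^sub>R One))|lborel. f' x)"
      by (rule set_integral_cont_up)
        (auto intro!: set_int simp: UN_box_eq_UNIV incseq_def subset_box_imp algebra_simps)
    then show ?thesis using box' by (simp add: UN_box_eq_UNIV LIMSEQ_const_iff)
  qed
  have "(LINT x:A|lborel. f' x) = 0" if A: "A \<in> sets lborel" for A
  proof -
    have "Int_stable (range (\<lambda>(a, b). box a b :: 'a set))"
      by (auto simp: Int_stable_def box_Int_box)
    moreover have "range (\<lambda>(a, b). box a b :: 'a set) \<subseteq> Pow UNIV" by simp
    moreover have "A \<in> sigma_sets UNIV (range (\<lambda>(a, b). box a b))"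
      using A by (simp add: borel_eq_box)
    ultimately show ?thesis
    proof (induction rule: sigma_sets_induct_disjoint)
      case (basic A)
      then show ?case using box' by auto
    next
      case (compl A)
      then have A: "A \<in> sets borel" by (simp add: borel_eq_box)
      have "(LINT x:A \<union> (UNIV - A)|lborel. f' x) =
          (LINT x:A|lborel. f' x) + (LINT x:UNIV - A|lborel. f' x)"
        by (rule set_integral_Un) (use A set_int in auto)
      then show ?case using compl UNIV0 by simp
    next
      case (union A)
      have A: "A i \<in> sets borel" for i using union(2) by (auto simp: borel_eq_box)
      have "(LINT x:(\<Union>i. A i)|lborel. f' x) = (\<Sum>i. LINT x:A i|lborel. f' x)"
        by (rule lebesgue_integral_countable_add)
          (use A set_int union(1) in \<open>auto simp: disjoint_family_on_def\<close>)
      then show ?case using union by simp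
    qed (simp add: set_lebesgue_integral_def)
  qed
  then have "AE x in lborel. f' x = 0" by (intro sigma_finite_measure.density_zero[OF sigma_finite_lborel int']) auto
  then have "AE x in lebesgue. f' x = 0" by (rule AE_completion)
  with eq' show ?thesis by eventually_elim simp
qed

text \<open>Box bumps converge boundedly to the indicator of the open box, so integrals of \<open>g\<close> over boxes
  whose closure lies in \<open>\<Omega>\<close> vanish. Since intersections of such a box with arbitrary boxes are again
  boxes of this kind, \<open>g\<close> cut off to it has vanishing integrals over all boxes. Finally \<open>\<Omega>\<close> is a
  countable union of closed boxes.\<close>
lemma fundamental_lemma_variations:
  fixes g :: "'a::euclidean_space \<Rightarrow> real"
  assumes "open \<Omega>"
    and int: "\<And>a b. cbox a b \<subseteq> \<Omega> \<Longrightarrow> set_integrable lebesgue (cbox a b) g"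
    and zero: "\<And>\<phi>. test_function \<Omega> \<phi> \<Longrightarrow> (LINT x:\<Omega>|lebesgue. g x * \<phi> x) = 0"
  shows "AE x\<in>\<Omega> in lebesgue. g x = 0"
proof -
  have box: "(LINT x:box a b|lebesgue. g x) = 0" if sub: "cbox a b \<subseteq> \<Omega>" for a b
  proof -
    \<comment> \<open>\<open>g\<close> need not be integrable on \<open>\<Omega>\<close>; cutting off to the closed box gives a dominating function.\<close>
    define G where "G x = indicat_real (cbox a b) x *\<^sub>R g x" for x
    have G: "integrable lebesgue G"
      using int[OF sub] by (simp add: G_def[abs_def] set_integrable_def)
    have bump: "box_bump a b m \<in> borel_measurable lebesgue" for m
      using Cn_box_bump[of 0 a b m]
      by (simp add: borel_measurable_continuous_onI measurable_completion)
    have "(\<lambda>m. LINT x|lebesgue. G x * box_bump a b m x) \<longlonglongrightarrow>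
        (LINT x|lebesgue. G x * indicator (box a b) x)"
    proof (rule integral_dominated_convergence)
      show "integrable lebesgue (\<lambda>x. \<bar>G x\<bar>)" using G by (rule integrable_abs)
      show "AE x in lebesgue. (\<lambda>m. G x * box_bump a b m x) \<longlonglongrightarrow> G x * indicator (box a b) x"
        by (intro AE_I2 tendsto_mult tendsto_const box_bump_tendsto)
      show "AE x in lebesgue. norm (G x * box_bump a b m x) \<le> \<bar>G x\<bar>" for m
        by (intro AE_I2) (simp add: abs_mult mult_left_le box_bump_bounds)
    qed (use G bump in \<open>auto intro!: borel_measurable_times borel_measurable_indicator\<close>)
    moreover have "(LINT x|lebesgue. G x * box_bump a b m x) = 0" for m
    proof -
      have "(LINT x|lebesgue. G x * box_bump a b m x) = (LINT x:\<Omega>|lebesgue. g x * box_bump a b m x)"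
        unfolding set_lebesgue_integral_def using sub box_subset_cbox[of a b]
        by (intro Bochner_Integration.integral_cong)
          (auto simp: G_def indicator_def intro!: box_bump_outside)
      then show ?thesis using zero[OF test_function_box_bump[OF sub]] by simp
    qed
    moreover have "(LINT x|lebesgue. G x * indicator (box a b) x) = (LINT x:box a b|lebesgue. g x)"
      unfolding set_lebesgue_integral_def using box_subset_cbox[of a b]
      by (intro Bochner_Integration.integral_cong) (auto simp: G_def indicator_def)
    ultimately show ?thesis by (simp add: LIMSEQ_const_iff)
  qed
  have cbox: "AE x in lebesgue. x \<in> cbox a b \<longrightarrow> g x = 0" if sub: "cbox a b \<subseteq> \<Omega>" for a b
  proof -
    have "AE x in lebesgue. indicat_real (box a b) x *\<^sub>R g x = 0"
    proof (rule AE_zero_if_box_integrals_zero)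
      have "set_integrable lebesgue (box a b) g"
        by (rule set_integrable_subset[OF int[OF sub]]) (auto simp: box_subset_cbox)
      then show "integrable lebesgue (\<lambda>x. indicat_real (box a b) x *\<^sub>R g x)"
        by (simp add: set_integrable_def)
      fix c d
      define p q where "p = (\<Sum>i\<in>Basis. max (c \<bullet> i) (a \<bullet> i) *\<^sub>R i)"
        and "q = (\<Sum>i\<in>Basis. min (d \<bullet> i) (b \<bullet> i) *\<^sub>R i)"
      have "box c d \<inter> box a b = box p q" and "cbox c d \<inter> cbox a b = cbox p q"
        by (simp_all add: box_Int_box Int_interval p_def q_def)
      moreover from this have "cbox p q \<subseteq> \<Omega>" using sub by blast
      moreover have "(LINT x:box c d|lebesgue. indicat_real (box a b) x *\<^sub>R g x) =
          (LINT x:box c d \<inter> box a b|lebesgue. g x)"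
        unfolding set_lebesgue_integral_def
        by (intro Bochner_Integration.integral_cong) (auto simp: indicator_def)
      ultimately show "(LINT x:box c d|lebesgue. indicat_real (box a b) x *\<^sub>R g x) = 0"
        using box by simp
    qed
    moreover have "AE x in lebesgue. x \<notin> cbox a b - box a b"
      using negligible_frontier_interval by (intro AE_not_in) (simp add: negligible_iff_null_sets)
    ultimately show ?thesis by eventually_elim (auto simp: indicator_def split: if_splits)
  qed
  obtain \<D> where D: "countable \<D>" "\<D> \<subseteq> Pow \<Omega>" "\<And>X. X \<in> \<D> \<Longrightarrow> \<exists>a b. X = cbox a b" "\<Union>\<D> = \<Omega>"
    using open_countable_Union_open_cbox[OF \<open>open \<Omega>\<close>] by metis
  have "AE x in lebesgue. \<forall>X\<in>\<D>. x \<in> X \<longrightarrow> g x = 0"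
    unfolding AE_ball_countable[OF D(1)] using cbox D(2,3) by blast
  then show ?thesis by eventually_elim (use D(4) in blast)
qed

section \<open>Square-integrable functions and weak gradients\<close>
lemma set_integrable_continuous_closure:
  fixes f :: "'a::euclidean_space \<Rightarrow> real"
  assumes "open \<Omega>" "bounded \<Omega>" "continuous_on (closure \<Omega>) f"
  shows "set_integrable lebesgue \<Omega> f"
proof -
  have "integrable lborel (\<lambda>x. indicator (closure \<Omega>) x *\<^sub>R f x)"
    using assms by (intro borel_integrable_compact) (auto simp: compact_closure)
  then have "set_integrable lebesgue (closure \<Omega>) f"
    unfolding set_integrable_def by (subst integrable_completion) auto
  then show ?thesis
    by (rule set_integrable_subset) (use assms(1) closure_subset in auto)
qed

lemma set_integrable_imp_measurable:
  "set_integrable M A f \<Longrightarrow> set_borel_measurable M A f"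
  by (simp add: set_integrable_def set_borel_measurable_def)

lemma L2_continuous_closure:
  fixes f :: "'a::euclidean_space \<Rightarrow> real"
  assumes "open \<Omega>" "bounded \<Omega>" "continuous_on (closure \<Omega>) f"
  shows "L2 \<Omega> f"
  unfolding L2_def using assms
  by (intro conjI set_integrable_imp_measurable set_integrable_continuous_closure)
    (auto intro!: continuous_intros)

lemma L2_mult_integrable:
  assumes "\<Omega> \<in> sets lebesgue" "L2 \<Omega> f" "L2 \<Omega> g"
  shows "set_integrable lebesgue \<Omega> (\<lambda>x. f x * g x)"
proof -
  have sq: "set_integrable lebesgue \<Omega> (\<lambda>x. (f x)\<^sup>2 + (g x)\<^sup>2)"
    using assms unfolding L2_def by (intro set_integral_add(1)) auto
  have "(\<lambda>x. (indicator \<Omega> x *\<^sub>R f x) * (indicator \<Omega> x *\<^sub>R g x)) \<in> borel_measurable lebesgue"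
    using assms unfolding L2_def set_borel_measurable_def by (intro borel_measurable_times) auto
  also have "(\<lambda>x. (indicator \<Omega> x *\<^sub>R f x) * (indicator \<Omega> x *\<^sub>R g x)) =
      (\<lambda>x. indicator \<Omega> x *\<^sub>R (f x * g x))"
    by (auto simp: indicator_def)
  finally have meas: "\<dots> \<in> borel_measurable lebesgue" .
  have "\<bar>f x * g x\<bar> \<le> (f x)\<^sup>2 + (g x)\<^sup>2" for x
    using sum_squares_bound[of "\<bar>f x\<bar>" "\<bar>g x\<bar>"] mult_nonneg_nonneg[of "\<bar>f x\<bar>" "\<bar>g x\<bar>"]
    unfolding abs_mult power2_abs by linarith
  then have "AE x in lebesgue. norm (indicator \<Omega> x *\<^sub>R (f x * g x)) \<le>
      norm (indicator \<Omega> x *\<^sub>R ((f x)\<^sup>2 + (g x)\<^sup>2))"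
    by (intro AE_I2) (auto simp: indicator_def)
  from Bochner_Integration.integrable_bound[OF sq[unfolded set_integrable_def] meas this]
  show ?thesis by (simp add: set_integrable_def)
qed

lemma L2_lincomb:
  assumes "\<Omega> \<in> sets lebesgue" "L2 \<Omega> f" "L2 \<Omega> g"
  shows "L2 \<Omega> (\<lambda>x. c * f x + d * g x)"
proof -
  have "(\<lambda>x. c * (indicator \<Omega> x *\<^sub>R f x) + d * (indicator \<Omega> x *\<^sub>R g x)) \<in> borel_measurable lebesgue"
    using assms unfolding L2_def set_borel_measurable_def
    by (intro borel_measurable_add borel_measurable_times borel_measurable_const) auto
  also have "(\<lambda>x. c * (indicator \<Omega> x *\<^sub>R f x) + d * (indicator \<Omega> x *\<^sub>R g x)) =
      (\<lambda>x. indicator \<Omega> x *\<^sub>R (c * f x + d * g x))"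
    by (auto simp: indicator_def)
  finally have "\<dots> \<in> borel_measurable lebesgue" .
  moreover have "set_integrable lebesgue \<Omega>
      (\<lambda>x. c\<^sup>2 * (f x)\<^sup>2 + (2 * c * d) * (f x * g x) + d\<^sup>2 * (g x)\<^sup>2)"
    using assms unfolding L2_def
    by (intro set_integral_add(1) set_integrable_mult_right L2_mult_integrable) (auto simp: L2_def)
  then have "set_integrable lebesgue \<Omega> (\<lambda>x. (c * f x + d * g x)\<^sup>2)"
    by (simp add: power2_eq_square algebra_simps)
  ultimately show ?thesis by (simp add: L2_def set_borel_measurable_def)
qed

lemma test_function_L2:
  assumes "open \<Omega>" "bounded \<Omega>" "test_function \<Omega> \<phi>"
  shows "L2 \<Omega> \<phi>" and "i \<in> Basis \<Longrightarrow> L2 \<Omega> (\<lambda>x. frechet_derivative \<phi> (at x) i)"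
proof -
  have *: "L2 \<Omega> f" if "continuous_on UNIV f" for f
    using continuous_on_subset[OF that subset_UNIV] by (rule L2_continuous_closure[OF assms(1,2)])
  have "Cn 0 \<phi>" and "Cn (Suc 0) \<phi>" using assms(3) by (auto simp only: test_function_def)
  then show "L2 \<Omega> \<phi>" and "i \<in> Basis \<Longrightarrow> L2 \<Omega> (\<lambda>x. frechet_derivative \<phi> (at x) i)"
    by (simp_all add: *)
qed

lemma L2_set_integrable:
  assumes "open \<Omega>" "bounded \<Omega>" "L2 \<Omega> f"
  shows "set_integrable lebesgue \<Omega> f"
  using L2_mult_integrable[OF _ assms(3) L2_continuous_closure[OF assms(1,2), of "\<lambda>_. 1"]] assms(1)
  by (auto simp: continuous_on_const)

text \<open>The difference of two weak gradients is orthogonal, component by component, to all test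
  functions.\<close>
lemma L2_weak_gradient_unique:
  assumes "open \<Omega>" "bounded \<Omega>" "L2_weak_gradient \<Omega> v g" "L2_weak_gradient \<Omega> v g'"
  shows "AE x\<in>\<Omega> in lebesgue. g x = g' x"
proof -
  have meas: "\<Omega> \<in> sets lebesgue" using assms(1) by auto
  have "AE x\<in>\<Omega> in lebesgue. g x \<bullet> i - g' x \<bullet> i = 0" if i: "i \<in> Basis" for i
  proof (rule fundamental_lemma_variations[OF assms(1)])
    have L2: "L2 \<Omega> (\<lambda>x. g x \<bullet> i)" "L2 \<Omega> (\<lambda>x. g' x \<bullet> i)"
      using assms(3,4) i by (auto simp: L2_weak_gradient_def)
    show "set_integrable lebesgue (cbox a b) (\<lambda>x. g x \<bullet> i - g' x \<bullet> i)"
      if "cbox a b \<subseteq> \<Omega>" for a b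
      by (rule set_integrable_subset[OF _ _ that])
        (auto intro!: set_integral_diff(1) L2_set_integrable assms(1,2) L2)
    fix \<phi> assume \<phi>: "test_function \<Omega> \<phi>"
    have "(LINT x:\<Omega>|lebesgue. (g x \<bullet> i) * \<phi> x) = (LINT x:\<Omega>|lebesgue. (g' x \<bullet> i) * \<phi> x)"
    proof -
      have "(LINT x:\<Omega>|lebesgue. v x * frechet_derivative \<phi> (at x) i) =
          - (LINT x:\<Omega>|lebesgue. (w x \<bullet> i) * \<phi> x)" if "L2_weak_gradient \<Omega> v w" for w
        using that i \<phi> by (simp add: L2_weak_gradient_def has_weak_gradient_def)
      from this[OF assms(3)] this[OF assms(4)] show ?thesis by simp
    qed
    moreover have "(LINT x:\<Omega>|lebesgue. (g x \<bullet> i) * \<phi> x - (g' x \<bullet> i) * \<phi> x) =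
        (LINT x:\<Omega>|lebesgue. (g x \<bullet> i) * \<phi> x) - (LINT x:\<Omega>|lebesgue. (g' x \<bullet> i) * \<phi> x)"
      by (intro set_integral_diff(2) L2_mult_integrable meas L2
            test_function_L2(1)[OF assms(1,2) \<phi>])
    ultimately show "(LINT x:\<Omega>|lebesgue. (g x \<bullet> i - g' x \<bullet> i) * \<phi> x) = 0"
      by (simp add: left_diff_distrib)
  qed
  from AE_finite_allI[OF finite_Basis this]
  have "AE x in lebesgue. \<forall>i\<in>Basis. x \<in> \<Omega> \<longrightarrow> g x \<bullet> i - g' x \<bullet> i = 0" .
  then show ?thesis
  proof eventually_elim
    case (elim x)
    show ?case
    proof
      assume "x \<in> \<Omega>"
      then have "g x \<bullet> i = g' x \<bullet> i" if "i \<in> Basis" for i using elim that by simp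
      then show "g x = g' x" by (rule euclidean_eqI)
    qed
  qed
qed

lemma L2_weak_gradient_lincomb:
  assumes "open \<Omega>" "bounded \<Omega>" "L2 \<Omega> u" "L2 \<Omega> v" "L2_weak_gradient \<Omega> u g" "L2_weak_gradient \<Omega> v g'"
  shows "L2_weak_gradient \<Omega> (\<lambda>x. c * u x + d * v x) (\<lambda>x. c *\<^sub>R g x + d *\<^sub>R g' x)"
proof -
  have meas: "\<Omega> \<in> sets lebesgue" using assms(1) by auto
  have "(LINT x:\<Omega>|lebesgue. (c * u x + d * v x) * frechet_derivative \<phi> (at x) i) =
      - (LINT x:\<Omega>|lebesgue. ((c *\<^sub>R g x + d *\<^sub>R g' x) \<bullet> i) * \<phi> x)"
    if \<phi>: "test_function \<Omega> \<phi>" and i: "i \<in> Basis" for \<phi> i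
  proof -
    note L2 = test_function_L2[OF assms(1,2) \<phi>]
    have lin: "(LINT x:\<Omega>|lebesgue. (c * f x + d * f' x) * h x) =
        c * (LINT x:\<Omega>|lebesgue. f x * h x) + d * (LINT x:\<Omega>|lebesgue. f' x * h x)"
      if "L2 \<Omega> f" "L2 \<Omega> f'" "L2 \<Omega> h" for f f' h
    proof -
      have "(LINT x:\<Omega>|lebesgue. (c * f x + d * f' x) * h x) =
          (LINT x:\<Omega>|lebesgue. c * (f x * h x) + d * (f' x * h x))"
        by (simp add: algebra_simps)
      also have "\<dots> = (LINT x:\<Omega>|lebesgue. c * (f x * h x)) + (LINT x:\<Omega>|lebesgue. d * (f' x * h x))"
        using that meas
        by (intro set_integral_add(2) set_integrable_mult_right L2_mult_integrable) auto
      finally show ?thesis by simp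
    qed
    show ?thesis
      using assms(5,6) i \<phi> lin[OF assms(3,4) L2(2)[OF i]]
        lin[OF _ _ L2(1), of "\<lambda>x. g x \<bullet> i" "\<lambda>x. g' x \<bullet> i"]
      by (simp add: L2_weak_gradient_def has_weak_gradient_def inner_add_left)
  qed
  moreover have "L2 \<Omega> (\<lambda>x. c * (g x \<bullet> i) + d * (g' x \<bullet> i))" if "i \<in> Basis" for i
    using assms(5,6) that meas by (intro L2_lincomb) (auto simp: L2_weak_gradient_def)
  ultimately show ?thesis
    by (simp add: L2_weak_gradient_def has_weak_gradient_def inner_add_left)
qed

lemma weak_gradient: "H1 \<Omega> v \<Longrightarrow> L2_weak_gradient \<Omega> v (weak_gradient \<Omega> v)"
  unfolding H1_def weak_gradient_def by (elim conjE someI_ex)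

lemma H1_lincomb:
  assumes "open \<Omega>" "bounded \<Omega>" "H1 \<Omega> u" "H1 \<Omega> v"
  shows "H1 \<Omega> (\<lambda>x. c * u x + d * v x)"
proof -
  have L2: "L2 \<Omega> u" "L2 \<Omega> v" using assms by (auto simp: H1_def)
  have "L2 \<Omega> (\<lambda>x. c * u x + d * v x)" using assms(1) L2 by (intro L2_lincomb) auto
  moreover note L2_weak_gradient_lincomb[OF assms(1,2) L2 weak_gradient[OF assms(3)] weak_gradient[OF assms(4)]]
  ultimately show ?thesis unfolding H1_def by blast
qed

lemma weak_gradient_inner_integrable:
  assumes "\<Omega> \<in> sets lebesgue" "H1 \<Omega> u" "H1 \<Omega> v"
  shows "set_integrable lebesgue \<Omega> (\<lambda>x. weak_gradient \<Omega> u x \<bullet> weak_gradient \<Omega> v x)"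
proof -
  have "integrable lebesgue (\<lambda>x. \<Sum>i\<in>Basis. indicator \<Omega> x *\<^sub>R
      ((weak_gradient \<Omega> u x \<bullet> i) * (weak_gradient \<Omega> v x \<bullet> i)))"
    using weak_gradient[OF assms(2)] weak_gradient[OF assms(3)] assms(1)
    by (intro Bochner_Integration.integrable_sum L2_mult_integrable[unfolded set_integrable_def])
      (auto simp: L2_weak_gradient_def)
  then show ?thesis
    unfolding set_integrable_def by (subst euclidean_inner) (simp add: sum_distrib_left)
qed

text \<open>The chosen gradient of a linear combination need not be the linear combination of the chosen
  gradients pointwise, but by uniqueness the two agree almost everywhere, which the integral does
  not see.\<close>
lemma A_form_lincomb_left:
  assumes "open \<Omega>" "bounded \<Omega>" "H1 \<Omega> u" "H1 \<Omega> v" "H1 \<Omega> w"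
  shows "A_form \<Omega> (\<lambda>_. \<kappa>) (\<lambda>x. c * u x + d * v x) w =
    c * A_form \<Omega> (\<lambda>_. \<kappa>) u w + d * A_form \<Omega> (\<lambda>_. \<kappa>) v w"
proof -
  have meas: "\<Omega> \<in> sets lebesgue" using assms(1) by auto
  let ?z = "\<lambda>x. c * u x + d * v x"
  let ?D = "weak_gradient \<Omega>"
  have "AE x\<in>\<Omega> in lebesgue. ?D ?z x = c *\<^sub>R ?D u x + d *\<^sub>R ?D v x"
    using assms
    by (intro L2_weak_gradient_unique[of \<Omega> ?z] weak_gradient H1_lincomb L2_weak_gradient_lincomb)
      (auto simp: H1_def)
  moreover have int: "set_integrable lebesgue \<Omega> (\<lambda>x. ?D p x \<bullet> ?D w x)" if "H1 \<Omega> p" for p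
    using weak_gradient_inner_integrable[OF meas that assms(5)] .
  moreover have "set_integrable lebesgue \<Omega>
      (\<lambda>x. c * (?D u x \<bullet> ?D w x) + d * (?D v x \<bullet> ?D w x))"
    using assms by (intro set_integral_add(1) set_integrable_mult_right int)
  ultimately have "(LINT x:\<Omega>|lebesgue. ?D ?z x \<bullet> ?D w x) =
      (LINT x:\<Omega>|lebesgue. c * (?D u x \<bullet> ?D w x) + d * (?D v x \<bullet> ?D w x))"
    using H1_lincomb[OF assms(1-4)]
    unfolding set_lebesgue_integral_def set_integrable_def
    by (intro integral_cong_AE borel_measurable_integrable)
      (auto elim!: eventually_mono simp: inner_add_left indicator_def)
  also have "\<dots> = c * (LINT x:\<Omega>|lebesgue. ?D u x \<bullet> ?D w x) + d * (LINT x:\<Omega>|lebesgue. ?D v x \<bullet> ?D w x)"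
    using assms by (subst set_integral_add(2)) (auto intro!: set_integrable_mult_right int)
  finally show ?thesis by (simp add: A_form_def algebra_simps)
qed

lemma A_form_commute: "A_form \<Omega> a u v = A_form \<Omega> a v u"
  by (simp add: A_form_def inner_commute)

lemma A_form_nonneg: "(\<And>x. a x \<ge> 0) \<Longrightarrow> A_form \<Omega> a v v \<ge> 0"
  by (auto simp: A_form_def set_lebesgue_integral_def intro!: Bochner_Integration.integral_nonneg)

section \<open>Galerkin problems on finite-dimensional spaces\<close>

text \<open>With the pointwise vector space structure on functions, spans and subspaces of the type class
  of real vector spaces apply to finite element spaces and, through the product instance, to pairs
  of unknowns.\<close>
instantiation "fun" :: (type, real_vector) real_vector
begin

definition "scaleR c f = (\<lambda>x. c *\<^sub>R f x)"

instance
  by standard (simp_all add: scaleR_fun_def fun_eq_iff scaleR_add_right scaleR_add_left)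

end

lemma scaleR_fun_apply [simp]: "(c *\<^sub>R f) x = c *\<^sub>R f x"
  by (simp add: scaleR_fun_def)

lemma fun_lincomb_eq:
  fixes u v :: "'a \<Rightarrow> real"
  shows "c *\<^sub>R u + d *\<^sub>R v = (\<lambda>x. c * u x + d * v x)"
  by (simp add: fun_eq_iff)

lemma sum_fun_apply: "(\<Sum>i\<in>A. f i) x = (\<Sum>i\<in>A. f i x)"
  by (induction A rule: infinite_finite_induct) simp_all

definition linear_form_on :: "'v::real_vector set \<Rightarrow> ('v \<Rightarrow> real) \<Rightarrow> bool" where
  "linear_form_on V L \<longleftrightarrow>
     (\<forall>u\<in>V. \<forall>v\<in>V. \<forall>c d. L (c *\<^sub>R u + d *\<^sub>R v) = c * L u + d * L v)"

lemma linear_form_onD: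
  "linear_form_on V L \<Longrightarrow> u \<in> V \<Longrightarrow> v \<in> V \<Longrightarrow> L (c *\<^sub>R u + d *\<^sub>R v) = c * L u + d * L v"
  by (simp add: linear_form_on_def)

lemma linear_form_on_diff: "linear_form_on V L \<Longrightarrow> u \<in> V \<Longrightarrow> v \<in> V \<Longrightarrow> L (u - v) = L u - L v"
  using linear_form_onD[of V L u v 1 "-1"] by simp

lemma linear_form_on_scaleR: "linear_form_on V L \<Longrightarrow> u \<in> V \<Longrightarrow> L (c *\<^sub>R u) = c * L u"
  using linear_form_onD[of V L u u c 0] by simp

text \<open>Induction on the spanning set, in the manner of Gram--Schmidt. A new vector \<open>e\<close> is
  replaced by \<open>r = e - p\<close>, where \<open>p\<close> solves the smaller problem with load \<open>a e\<close>, so that \<open>a r\<close> vanishes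
  on the smaller space. Definiteness makes \<open>a r r\<close> nonzero, and a multiple of \<open>r\<close> corrects the solution
  of the smaller problem.\<close>
lemma galerkin_on_span:
  fixes a :: "'v::real_vector \<Rightarrow> 'v \<Rightarrow> real"
  assumes "finite S" "S \<subseteq> V" and V: "subspace V"
    and left: "\<And>w. w \<in> V \<Longrightarrow> linear_form_on V (\<lambda>u. a u w)"
    and right: "\<And>u. u \<in> V \<Longrightarrow> linear_form_on V (a u)"
    and definite: "\<And>v. v \<in> V \<Longrightarrow> a v v = 0 \<Longrightarrow> v = 0"
    and "linear_form_on V L"
  shows "\<exists>u\<in>span S. \<forall>w\<in>span S. a u w = L w"
  using assms(1,2,7)
proof (induction S arbitrary: L rule: finite_induct)
  case empty
  have "0 \<in> V" using V by (rule subspace_0)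
  then have "L 0 = 0" "a 0 0 = 0"
    using linear_form_on_scaleR[of V L 0 0] linear_form_on_scaleR[of V "a 0" 0 0] empty right
    by simp_all
  then show ?case by simp
next
  case (insert e S)
  have eV: "e \<in> V" and SV: "span S \<subseteq> V"
    using insert.prems V span_minimal[of S V] by auto
  have IH: "\<exists>u\<in>span S. \<forall>w\<in>span S. a u w = L' w" if "linear_form_on V L'" for L'
    using insert.IH insert.prems that by simp
  show ?case
  proof (cases "e \<in> span S")
    case True
    then show ?thesis using IH[OF insert.prems(2)] by (simp add: span_redundant)
  next
    case False
    obtain p where p: "p \<in> span S" "\<And>w. w \<in> span S \<Longrightarrow> a p w = a e w"
      using IH[OF right[OF eV]] by blast
    obtain u where u: "u \<in> span S" "\<And>w. w \<in> span S \<Longrightarrow> a u w = L w"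
      using IH[OF insert.prems(2)] by blast
    define r where "r = e - p"
    have "p \<in> V" "u \<in> V" using p(1) u(1) SV by auto
    then have "r \<in> V" using eV V unfolding r_def by (intro subspace_diff)
    have r0: "a r w = 0" if "w \<in> span S" for w
    proof -
      have "w \<in> V" using that SV by auto
      then show ?thesis
        using linear_form_on_diff[OF left eV \<open>p \<in> V\<close>] p(2)[OF that] by (simp add: r_def)
    qed
    have "r \<noteq> 0" using False p(1) by (auto simp: r_def)
    then have arr: "a r r \<noteq> 0" using definite \<open>r \<in> V\<close> by blast
    \<comment> \<open>This \<open>t\<close> makes the equation hold for \<open>w = r\<close>; on \<open>span S\<close> adding a multiple of \<open>r\<close> changes nothing.\<close>
    define t where "t = (L r - a u r) / a r r"
    define z where "z = u + t *\<^sub>R r"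
    have rs: "r \<in> span (insert e S)"
      unfolding r_def using p(1) span_mono[of S "insert e S"] by (intro span_diff) (auto intro: span_base)
    then have "z \<in> span (insert e S)"
      unfolding z_def using u(1) span_mono[of S "insert e S"]
      by (intro span_add span_scale) auto
    moreover have "a z w = L w" if w: "w \<in> span (insert e S)" for w
    proof -
      from w obtain k where k: "w - k *\<^sub>R e \<in> span S" by (auto simp: span_breakdown_eq)
      define s where "s = (w - k *\<^sub>R e) + k *\<^sub>R p"
      have s: "s \<in> span S" unfolding s_def using k p(1) by (intro span_add span_scale)
      have sV: "s \<in> V" using s SV by auto
      have w_eq: "w = 1 *\<^sub>R s + k *\<^sub>R r" by (simp add: s_def r_def algebra_simps)
      have wV: "w \<in> V"
        unfolding w_eq using V sV \<open>r \<in> V\<close> by (intro subspace_add subspace_scale)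
      have "a z w = a u w + t * a r w"
        using linear_form_onD[OF left[OF wV] \<open>u \<in> V\<close> \<open>r \<in> V\<close>, of 1 t] by (simp add: z_def)
      also have "a u w = L s + k * a u r"
        unfolding w_eq using linear_form_onD[OF right[OF \<open>u \<in> V\<close>] sV \<open>r \<in> V\<close>, of 1 k] u(2)[OF s] by simp
      also have "a r w = k * a r r"
        unfolding w_eq using linear_form_onD[OF right[OF \<open>r \<in> V\<close>] sV \<open>r \<in> V\<close>, of 1 k] r0[OF s] by simp
      also have "L s + k * a u r + t * (k * a r r) = L s + k * L r"
        using arr by (simp add: t_def field_simps)
      also have "\<dots> = L w"
        unfolding w_eq using linear_form_onD[OF insert.prems(2) sV \<open>r \<in> V\<close>, of 1 k] by simp
      finally show ?thesis .
    qed
    ultimately show ?thesis by blast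
  qed
qed

text \<open>The spanning set \<open>S\<close> may lie outside \<open>V\<close>; this suits spaces such as finite element spaces that
  are known only as subspaces of an explicitly spanned space.\<close>
lemma galerkin_unique_solution:
  fixes a :: "'v::real_vector \<Rightarrow> 'v \<Rightarrow> real"
  assumes "finite S" "V \<subseteq> span S" and V: "subspace V"
    and left: "\<And>w. w \<in> V \<Longrightarrow> linear_form_on V (\<lambda>u. a u w)"
    and right: "\<And>u. u \<in> V \<Longrightarrow> linear_form_on V (a u)"
    and definite: "\<And>v. v \<in> V \<Longrightarrow> a v v = 0 \<Longrightarrow> v = 0"
    and L: "linear_form_on V L"
  shows "\<exists>!u. u \<in> V \<and> (\<forall>w\<in>V. a u w = L w)"
proof -
  obtain B where B: "B \<subseteq> V" "independent B" "V \<subseteq> span B"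
    by (rule maximal_independent_subset)
  then have "finite B" using independent_span_bound[OF \<open>finite S\<close>] assms(2) by blast
  moreover have "span B = V" using B V by (simp add: span_minimal subset_antisym)
  ultimately obtain u where u: "u \<in> V" "\<forall>w\<in>V. a u w = L w"
    using galerkin_on_span[OF _ B(1) V left right definite L] by blast
  moreover have "u' = u" if "u' \<in> V" "\<forall>w\<in>V. a u' w = L w" for u'
  proof -
    have d: "u' - u \<in> V" using V u(1) that(1) by (intro subspace_diff)
    then have "a (u' - u) (u' - u) = 0"
      using linear_form_on_diff[OF left[OF d] that(1) u(1)] u(2) that(2) by simp
    with d show ?thesis using definite by fastforce
  qed
  ultimately show ?thesis by blast
qed

lemma finite_spanning_set_Times:
  assumes "finite S" "V \<subseteq> span S"
  shows "\<exists>S'. finite S' \<and> V \<times> V \<subseteq> span S'"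
proof (intro exI conjI subsetI)
  let ?S = "(\<lambda>v. (v, 0)) ` S \<union> (\<lambda>v. (0, v)) ` S"
  show "finite ?S" using assms(1) by simp
  fix p assume "p \<in> V \<times> V"
  then obtain u w where p: "p = (u, w)" "u \<in> span S" "w \<in> span S" using assms(2) by auto
  have "(u, 0) \<in> span ((\<lambda>v. (v, 0)) ` S)"
    using p(2) by (subst linear_span_image) (auto intro!: linearI)
  moreover have "(0, w) \<in> span ((\<lambda>v. (0, v)) ` S)"
    using p(3) by (subst linear_span_image) (auto intro!: linearI)
  ultimately have "(u, 0) + (0, w) \<in> span ?S"
    by (intro span_add) (auto intro: span_mono[THEN subsetD, rotated])
  then show "p \<in> span ?S" using p by simp
qed

section \<open>The finite element space\<close>
lemma poly_deg_le_lincomb: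
  assumes "p \<in> poly_deg_le k" "q \<in> poly_deg_le k"
  shows "(\<lambda>x. c * p x + d * q x) \<in> poly_deg_le k"
proof -
  obtain c1 c2 where
    "\<And>x. p x = (\<Sum>\<alpha> \<in> {\<alpha> \<in> Basis \<rightarrow>\<^sub>E {..k}. (\<Sum>i\<in>Basis. \<alpha> i) \<le> k}. c1 \<alpha> * (\<Prod>i\<in>Basis. (x \<bullet> i) ^ \<alpha> i))"
    "\<And>x. q x = (\<Sum>\<alpha> \<in> {\<alpha> \<in> Basis \<rightarrow>\<^sub>E {..k}. (\<Sum>i\<in>Basis. \<alpha> i) \<le> k}. c2 \<alpha> * (\<Prod>i\<in>Basis. (x \<bullet> i) ^ \<alpha> i))"
    using assms unfolding poly_deg_le_def by auto
  then show ?thesis unfolding poly_deg_le_def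
    by (intro CollectI exI[of _ "\<lambda>\<alpha>. c * c1 \<alpha> + d * c2 \<alpha>"])
      (simp add: sum_distrib_left sum.distrib algebra_simps)
qed

lemma H1_zero:
  assumes "open \<Omega>" "bounded \<Omega>" shows "H1 \<Omega> (\<lambda>x. 0)"
proof -
  have "L2 \<Omega> (\<lambda>x. 0)" using assms by (intro L2_continuous_closure) auto
  moreover from this have "L2_weak_gradient \<Omega> (\<lambda>x. 0) (\<lambda>x. 0)"
    by (simp add: L2_weak_gradient_def has_weak_gradient_def)
  ultimately show ?thesis by (auto simp: H1_def)
qed

lemma subspace_fe_space:
  assumes "open \<Omega>" "bounded \<Omega>"
  shows "subspace (fe_space \<Omega> \<T> k)"
proof -
  have "(\<lambda>x. 0) \<in> poly_deg_le k"
    unfolding poly_deg_le_def by (intro CollectI exI[of _ "\<lambda>\<alpha>. 0"]) simp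
  then have zero: "0 \<in> fe_space \<Omega> \<T> k"
    using H1_zero[OF assms] by (auto simp: fe_space_def func_zero)
  have lin: "c *\<^sub>R u + d *\<^sub>R v \<in> fe_space \<Omega> \<T> k"
    if "u \<in> fe_space \<Omega> \<T> k" "v \<in> fe_space \<Omega> \<T> k" for u v c d
  proof -
    have "\<exists>p\<in>poly_deg_le k. \<forall>x\<in>T. c * u x + d * v x = p x" if "T \<in> \<T>" for T
    proof -
      obtain p q where "p \<in> poly_deg_le k" "q \<in> poly_deg_le k"
        "\<forall>x\<in>T. u x = p x" "\<forall>x\<in>T. v x = q x"
        using \<open>T \<in> \<T>\<close> \<open>u \<in> _\<close> \<open>v \<in> _\<close> unfolding fe_space_def by blast
      then show ?thesis
        by (intro bexI[of _ "\<lambda>x. c * p x + d * q x"] poly_deg_le_lincomb) auto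
    qed
    then show ?thesis
      using that H1_lincomb[OF assms]
      by (auto simp: fe_space_def fun_lincomb_eq intro!: continuous_intros)
  qed
  show ?thesis
    using zero lin[of _ _ 1 1] lin[of _ 0 _ 0] by (intro subspaceI) (auto simp: zero)
qed

text \<open>Assign to every point \<open>x\<close> of the closure one cell \<open>\<tau> x\<close> containing it. The monomials cut off to the
  sets where \<open>\<tau>\<close> is constant are finitely many and in general
  discontinuous, hence outside the space, but every element of the space is a combination of them. On faces shared by several cells the
  choice made by \<open>\<tau>\<close> is harmless because all local polynomials agree with \<open>v\<close> there.\<close>
lemma fe_space_finite_dimensional:
  fixes \<Omega> :: "'a::euclidean_space set"
  assumes "finite \<T>" "closure \<Omega> \<subseteq> \<Union>\<T>"
  shows "\<exists>S. finite S \<and> fe_space \<Omega> \<T> k \<subseteq> span S"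
proof -
  define M where "M = {\<alpha> \<in> Basis \<rightarrow>\<^sub>E {..k}. (\<Sum>i\<in>(Basis::'a set). \<alpha> i) \<le> k}"
  have "finite M"
    unfolding M_def by (rule finite_subset[OF _ finite_PiE[of Basis "\<lambda>_. {..k}"]]) auto
  have "\<forall>x\<in>closure \<Omega>. \<exists>T. T \<in> \<T> \<and> x \<in> T" using assms(2) by blast
  then obtain \<tau> where \<tau>: "\<And>x. x \<in> closure \<Omega> \<Longrightarrow> \<tau> x \<in> \<T> \<and> x \<in> \<tau> x" by metis
  define g where "g T \<alpha> = (\<lambda>x. if x \<in> closure \<Omega> \<and> \<tau> x = T then \<Prod>i\<in>Basis. (x \<bullet> i) ^ \<alpha> i else 0)"
    for T and \<alpha> :: "'a \<Rightarrow> nat"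
  have "v \<in> span ((\<lambda>(T, \<alpha>). g T \<alpha>) ` (\<T> \<times> M))" if v: "v \<in> fe_space \<Omega> \<T> k" for v
  proof -
    have "\<forall>T\<in>\<T>. \<exists>c. \<forall>x\<in>T. v x = (\<Sum>\<alpha>\<in>M. c \<alpha> * (\<Prod>i\<in>Basis. (x \<bullet> i) ^ \<alpha> i))"
    proof
      fix T assume "T \<in> \<T>"
      then obtain p where "p \<in> poly_deg_le k" "\<forall>x\<in>T. v x = p x"
        using v unfolding fe_space_def by blast
      then show "\<exists>c. \<forall>x\<in>T. v x = (\<Sum>\<alpha>\<in>M. c \<alpha> * (\<Prod>i\<in>Basis. (x \<bullet> i) ^ \<alpha> i))"
        unfolding poly_deg_le_def M_def by auto
    qed
    then obtain c where
      c: "\<And>T x. T \<in> \<T> \<Longrightarrow> x \<in> T \<Longrightarrow> v x = (\<Sum>\<alpha>\<in>M. c T \<alpha> * (\<Prod>i\<in>Basis. (x \<bullet> i) ^ \<alpha> i))"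
      by metis
    have "v x = (\<Sum>T\<in>\<T>. \<Sum>\<alpha>\<in>M. c T \<alpha> *\<^sub>R g T \<alpha>) x" for x
    proof (cases "x \<in> closure \<Omega>")
      case True
      have "(\<Sum>T\<in>\<T>. \<Sum>\<alpha>\<in>M. c T \<alpha> *\<^sub>R g T \<alpha>) x =
          (\<Sum>T\<in>\<T>. if \<tau> x = T then \<Sum>\<alpha>\<in>M. c T \<alpha> * (\<Prod>i\<in>Basis. (x \<bullet> i) ^ \<alpha> i) else 0)"
        unfolding sum_fun_apply using True by (intro sum.cong) (auto simp: g_def)
      also have "\<dots> = (\<Sum>\<alpha>\<in>M. c (\<tau> x) \<alpha> * (\<Prod>i\<in>Basis. (x \<bullet> i) ^ \<alpha> i))"
        using \<tau>[OF True] assms(1) by (simp add: sum.delta')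
      also have "\<dots> = v x" using c[of "\<tau> x" x] \<tau>[OF True] by simp
      finally show ?thesis by simp
    next
      case False
      then show ?thesis using v by (simp add: sum_fun_apply g_def fe_space_def)
    qed
    then have "v = (\<Sum>T\<in>\<T>. \<Sum>\<alpha>\<in>M. c T \<alpha> *\<^sub>R g T \<alpha>)" by (rule ext)
    moreover have "\<dots> \<in> span ((\<lambda>(T, \<alpha>). g T \<alpha>) ` (\<T> \<times> M))"
      by (intro span_sum span_scale span_base) auto
    ultimately show ?thesis by simp
  qed
  then have "fe_space \<Omega> \<T> k \<subseteq> span ((\<lambda>(T, \<alpha>). g T \<alpha>) ` (\<T> \<times> M))" by blast
  then show ?thesis
    using assms(1) \<open>finite M\<close> by (intro exI[of _ "(\<lambda>(T, \<alpha>). g T \<alpha>) ` (\<T> \<times> M)"]) simp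
qed

section \<open>One step of the scheme\<close>

text \<open>What the analysis of a step uses about the finite element space.\<close>
locale conforming_space =
  fixes \<Omega> :: "'a::euclidean_space set" and V :: "('a \<Rightarrow> real) set"
  assumes open_\<Omega>: "open \<Omega>" and bounded_\<Omega>: "bounded \<Omega>"
    and subspace_V: "subspace V"
    and finite_dim: "\<exists>S. finite S \<and> V \<subseteq> span S"
    and cont: "v \<in> V \<Longrightarrow> continuous_on (closure \<Omega>) v"
    and H1: "v \<in> V \<Longrightarrow> H1 \<Omega> v"
    and vanish: "v \<in> V \<Longrightarrow> x \<notin> closure \<Omega> \<Longrightarrow> v x = 0"
begin

lemma lincomb:
  assumes "u \<in> V" "v \<in> V" shows "(\<lambda>x. c * u x + d * v x) \<in> V"
proof -
  have "c *\<^sub>R u + d *\<^sub>R v \<in> V" by (intro subspace_add subspace_scale subspace_V assms)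
  then show ?thesis by (simp add: fun_lincomb_eq)
qed

lemma L2_inner_lincomb_left:
  assumes "continuous_on (closure \<Omega>) f" "continuous_on (closure \<Omega>) g" "continuous_on (closure \<Omega>) w"
  shows "L2_inner \<Omega> (\<lambda>x. c * f x + d * g x) w = c * L2_inner \<Omega> f w + d * L2_inner \<Omega> g w"
proof -
  have "L2_inner \<Omega> (\<lambda>x. c * f x + d * g x) w =
      (LINT x:\<Omega>|lebesgue. c * (f x * w x) + d * (g x * w x))"
    by (simp add: L2_inner_def algebra_simps)
  also have "\<dots> = (LINT x:\<Omega>|lebesgue. c * (f x * w x)) + (LINT x:\<Omega>|lebesgue. d * (g x * w x))"
    by (intro set_integral_add(2) set_integrable_continuous_closure open_\<Omega> bounded_\<Omega>
        continuous_on_mult continuous_on_const assms)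
  finally show ?thesis by (simp add: L2_inner_def)
qed

lemma L2_inner_commute: "L2_inner \<Omega> f g = L2_inner \<Omega> g f"
  by (simp add: L2_inner_def mult.commute)

lemma L2_inner_nonneg: "0 \<le> L2_inner \<Omega> f f"
  unfolding L2_inner_def set_lebesgue_integral_def by (rule integral_nonneg_AE) auto

text \<open>A vanishing norm only gives \<open>v = 0\<close> almost everywhere in \<open>\<Omega>\<close>. Continuity extends this to all of \<open>\<Omega>\<close>
  and then to its closure, and outside the closure elements of \<open>V\<close> vanish by convention.\<close>
lemma L2_inner_definite:
  assumes "v \<in> V" "L2_inner \<Omega> v v = 0" shows "v = 0"
proof -
  have "integrable lebesgue (\<lambda>x. indicator \<Omega> x *\<^sub>R (v x * v x))"
    using set_integrable_continuous_closure[OF open_\<Omega> bounded_\<Omega>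
        continuous_on_mult[OF cont[OF assms(1)] cont[OF assms(1)]]]
    by (simp add: set_integrable_def)
  then have "AE x in lebesgue. indicator \<Omega> x *\<^sub>R (v x * v x) = 0"
    using assms(2) unfolding L2_inner_def set_lebesgue_integral_def
    by (subst (asm) integral_nonneg_eq_0_iff_AE) auto
  then have ae: "AE x\<in>\<Omega> in lebesgue. x \<in> {x \<in> closure \<Omega>. v x = 0}"
    by eventually_elim (use closure_subset[of \<Omega>] in \<open>auto simp: indicator_def\<close>)
  have "closed {x \<in> closure \<Omega>. v x = 0}"
    using continuous_closed_preimage_constant[OF cont[OF assms(1)] closed_closure] .
  from mem_closed_if_AE_lebesgue_open[OF open_\<Omega> this ae]
  have "v x = 0" if "x \<in> \<Omega>" for x using that by blast
  then have "v x = 0" if "x \<in> closure \<Omega>" for x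
    using continuous_constant_on_closure[OF cont[OF assms(1)] _ that] by blast
  then show ?thesis using vanish[OF assms(1)] by (auto simp: fun_eq_iff)
qed

end

locale crank_nicolson_step = conforming_space \<Omega> V
  for \<Omega> :: "'a::euclidean_space set" and V +
  fixes h :: "'a \<Rightarrow> real" and \<epsilon> \<Delta>t :: real and u_n U_n :: "'a \<Rightarrow> real"
  assumes h: "continuous_on (closure \<Omega>) h"
    and dt: "\<Delta>t > 0"
    and u_n: "u_n \<in> V" and U_n: "U_n \<in> V"
begin

abbreviation I :: "('a \<Rightarrow> real) \<Rightarrow> ('a \<Rightarrow> real) \<Rightarrow> real" where "I \<equiv> L2_inner \<Omega>"
abbreviation D :: "('a \<Rightarrow> real) \<Rightarrow> ('a \<Rightarrow> real) \<Rightarrow> real" where "D \<equiv> A_form \<Omega> (\<lambda>_. \<epsilon>\<^sup>2)"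
abbreviation J :: "('a \<Rightarrow> real) \<Rightarrow> ('a \<Rightarrow> real) \<Rightarrow> real" where "J u v \<equiv> I (\<lambda>x. h x * u x) v"

lemma J_commute: "J u v = J v u"
  by (simp add: L2_inner_def mult.commute mult.left_commute)

lemma I_lincomb:
  assumes "u \<in> V" "v \<in> V" "w \<in> V"
  shows "I (\<lambda>x. c * u x + d * v x) w = c * I u w + d * I v w"
    and "I w (\<lambda>x. c * u x + d * v x) = c * I w u + d * I w v"
  using L2_inner_lincomb_left[of u v w c d] assms by (simp_all add: cont L2_inner_commute[of w])

lemma D_lincomb:
  assumes "u \<in> V" "v \<in> V" "w \<in> V"
  shows "D (\<lambda>x. c * u x + d * v x) w = c * D u w + d * D v w"
    and "D w (\<lambda>x. c * u x + d * v x) = c * D w u + d * D w v"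
  using A_form_lincomb_left[OF open_\<Omega> bounded_\<Omega>, of u v w "\<epsilon>\<^sup>2" c d] assms
  by (simp_all add: H1 A_form_commute[of _ _ w])

lemma J_lincomb:
  assumes "u \<in> V" "v \<in> V" "w \<in> V"
  shows "J (\<lambda>x. c * u x + d * v x) w = c * J u w + d * J v w"
    and "J w (\<lambda>x. c * u x + d * v x) = c * J w u + d * J w v"
proof -
  have "(\<lambda>x. h x * (c * u x + d * v x)) = (\<lambda>x. c * (h x * u x) + d * (h x * v x))"
    by (simp add: algebra_simps)
  then show "J (\<lambda>x. c * u x + d * v x) w = c * J u w + d * J v w"
    using assms by (simp add: L2_inner_lincomb_left continuous_on_mult cont h)
  then show "J w (\<lambda>x. c * u x + d * v x) = c * J w u + d * J w v"
    by (simp add: J_commute[of w])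
qed

text \<open>The sum of the two equations in the half increments, the second one weighted so that the coupling terms
  \<open>J Z \<phi>\<close> and \<open>- J w \<psi>\<close> are skew to each other.\<close>
definition step_form ::
  "('a \<Rightarrow> real) \<times> ('a \<Rightarrow> real) \<Rightarrow> ('a \<Rightarrow> real) \<times> ('a \<Rightarrow> real) \<Rightarrow> real" where
  "step_form = (\<lambda>(w, Z) (\<phi>, \<psi>). 2 / \<Delta>t * I w \<phi> + D w \<phi> + J Z \<phi> + 2 * I Z \<psi> - J w \<psi>)"

definition step_load :: "('a \<Rightarrow> real) \<times> ('a \<Rightarrow> real) \<Rightarrow> real" where
  "step_load = (\<lambda>(\<phi>, \<psi>). - D u_n \<phi> - J U_n \<phi>)"

lemma step_form_linear_left:
  assumes "q \<in> V \<times> V" shows "linear_form_on (V \<times> V) (\<lambda>p. step_form p q)"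
proof -
  obtain \<phi> \<psi> where q: "q = (\<phi>, \<psi>)" "\<phi> \<in> V" "\<psi> \<in> V" using assms by auto
  have "step_form (c *\<^sub>R (w, Z) + d *\<^sub>R (w', Z')) q = c * step_form (w, Z) q + d * step_form (w', Z') q"
    if "w \<in> V" "Z \<in> V" "w' \<in> V" "Z' \<in> V" for c d w Z w' Z'
    using that q
    by (simp add: step_form_def fun_lincomb_eq I_lincomb D_lincomb J_lincomb) (simp add: algebra_simps add_divide_distrib)
  then show ?thesis by (auto simp: linear_form_on_def)
qed

lemma step_form_linear_right:
  assumes "p \<in> V \<times> V" shows "linear_form_on (V \<times> V) (step_form p)"
proof -
  obtain w Z where p: "p = (w, Z)" "w \<in> V" "Z \<in> V" using assms by auto
  have "step_form p (c *\<^sub>R (\<phi>, \<psi>) + d *\<^sub>R (\<phi>', \<psi>')) = c * step_form p (\<phi>, \<psi>) + d * step_form p (\<phi>', \<psi>')"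
    if "\<phi> \<in> V" "\<psi> \<in> V" "\<phi>' \<in> V" "\<psi>' \<in> V" for c d \<phi> \<psi> \<phi>' \<psi>'
    using that p
    by (simp add: step_form_def fun_lincomb_eq I_lincomb D_lincomb J_lincomb) (simp add: algebra_simps add_divide_distrib)
  then show ?thesis by (auto simp: linear_form_on_def)
qed

lemma step_load_linear: "linear_form_on (V \<times> V) step_load"
proof -
  have "step_load (c *\<^sub>R (\<phi>, \<psi>) + d *\<^sub>R (\<phi>', \<psi>')) = c * step_load (\<phi>, \<psi>) + d * step_load (\<phi>', \<psi>')"
    if "\<phi> \<in> V" "\<psi> \<in> V" "\<phi>' \<in> V" "\<psi>' \<in> V" for c d \<phi> \<psi> \<phi>' \<psi>'
    using that u_n U_n
    by (simp add: step_load_def fun_lincomb_eq I_lincomb D_lincomb J_lincomb) (simp add: algebra_simps add_divide_distrib)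
  then show ?thesis by (auto simp: linear_form_on_def)
qed

text \<open>On the diagonal the coupling terms cancel for every \<open>h\<close>, so no restriction on \<open>\<Delta>t\<close> arises.\<close>
lemma step_form_definite:
  assumes "p \<in> V \<times> V" "step_form p p = 0" shows "p = 0"
proof -
  obtain w Z where p: "p = (w, Z)" "w \<in> V" "Z \<in> V" using assms by auto
  have "2 / \<Delta>t * I w w + D w w + 2 * I Z Z = 0"
    using assms(2) J_commute[of Z w] by (simp add: p step_form_def)
  moreover have "0 \<le> 2 / \<Delta>t * I w w" using dt L2_inner_nonneg[of w] by simp
  moreover have "0 \<le> D w w" by (simp add: A_form_nonneg)
  moreover have "0 \<le> I Z Z" by (rule L2_inner_nonneg)
  ultimately have "2 / \<Delta>t * I w w = 0" "I Z Z = 0" by linarith+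
  then have "w = 0" "Z = 0" using dt p L2_inner_definite by auto
  then show ?thesis by (simp add: p zero_prod_def)
qed

lemma step_form_unique_solution:
  "\<exists>!p. p \<in> V \<times> V \<and> (\<forall>q\<in>V \<times> V. step_form p q = step_load q)"
proof -
  obtain S where S: "finite S" "V \<times> V \<subseteq> span S"
    using finite_dim finite_spanning_set_Times by blast
  show ?thesis
    by (rule galerkin_unique_solution[OF S subspace_Times[OF subspace_V subspace_V]
          step_form_linear_left step_form_linear_right step_form_definite step_load_linear])
qed

text \<open>Written as a linear combination, like \<open>1 * u\<^sub>n + 2 * w\<close> and similar terms below, so that the
  bilinearity lemmas apply literally.\<close>
definition half_increment :: "('a \<Rightarrow> real) \<Rightarrow> ('a \<Rightarrow> real) \<Rightarrow> 'a \<Rightarrow> real" where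
  "half_increment v_n v = (\<lambda>x. 1 / 2 * v x + (- 1 / 2) * v_n x)"

abbreviation solves :: "('a \<Rightarrow> real) \<Rightarrow> ('a \<Rightarrow> real) \<Rightarrow> bool" where
  "solves \<equiv> scheme_solution V \<Omega> \<epsilon> \<Delta>t h u_n U_n"

lemma half_increment_in_V: "v_n \<in> V \<Longrightarrow> v \<in> V \<Longrightarrow> half_increment v_n v \<in> V"
  unfolding half_increment_def by (rule lincomb)

text \<open>Midpoint values and midpoint difference quotients are affine in the half increments:
  \<open>u\<^sub>m\<^sub>i\<^sub>d = u\<^sub>n + w\<close> and \<open>u\<^sub>m\<^sub>i\<^sub>d - u\<^sub>n = w\<close>.\<close>
lemma scheme_equations:
  assumes "u \<in> V" "U \<in> V" "\<phi> \<in> V"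
  defines "w \<equiv> half_increment u_n u" and "Z \<equiv> half_increment U_n U"
  shows "L2_inner \<Omega> (\<lambda>x. (midpoint_fun u_n u x - u_n x) / (1/2 * \<Delta>t)) \<phi> = 2 / \<Delta>t * I w \<phi>"
    and "L2_inner \<Omega> (\<lambda>x. (midpoint_fun U_n U x - U_n x) / (1/2 * \<Delta>t)) \<phi> = 2 / \<Delta>t * I Z \<phi>"
    and "L2_inner \<Omega> (\<lambda>x. 1/2 * h x * ((midpoint_fun u_n u x - u_n x) / (1/2 * \<Delta>t))) \<phi> =
      1 / \<Delta>t * J w \<phi>"
    and "A_form \<Omega> (\<lambda>_. \<epsilon>\<^sup>2) (midpoint_fun u_n u) \<phi> = D u_n \<phi> + D w \<phi>"
    and "L2_inner \<Omega> (\<lambda>x. h x * midpoint_fun U_n U x) \<phi> = J U_n \<phi> + J Z \<phi>"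
proof -
  have wZ: "w \<in> V" "Z \<in> V"
    unfolding w_def Z_def using assms(1,2) u_n U_n by (auto intro: half_increment_in_V)
  have mid: "midpoint_fun u_n u = (\<lambda>x. 1 * u_n x + 1 * w x)"
    "midpoint_fun U_n U = (\<lambda>x. 1 * U_n x + 1 * Z x)"
    by (auto simp: midpoint_fun_def w_def Z_def half_increment_def fun_eq_iff field_simps)
  have scale: "I (\<lambda>x. c * f x) g = c * I f g" for c f g
    by (simp add: L2_inner_def mult.assoc)
  have "(\<lambda>x. (midpoint_fun u_n u x - u_n x) / (1/2 * \<Delta>t)) = (\<lambda>x. 2 / \<Delta>t * w x)"
    "(\<lambda>x. (midpoint_fun U_n U x - U_n x) / (1/2 * \<Delta>t)) = (\<lambda>x. 2 / \<Delta>t * Z x)"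
    "(\<lambda>x. 1/2 * h x * ((midpoint_fun u_n u x - u_n x) / (1/2 * \<Delta>t))) =
      (\<lambda>x. 1 / \<Delta>t * (h x * w x))"
    by (simp_all add: mid fun_eq_iff)
  then show "L2_inner \<Omega> (\<lambda>x. (midpoint_fun u_n u x - u_n x) / (1/2 * \<Delta>t)) \<phi> = 2 / \<Delta>t * I w \<phi>"
    "L2_inner \<Omega> (\<lambda>x. (midpoint_fun U_n U x - U_n x) / (1/2 * \<Delta>t)) \<phi> = 2 / \<Delta>t * I Z \<phi>"
    "L2_inner \<Omega> (\<lambda>x. 1/2 * h x * ((midpoint_fun u_n u x - u_n x) / (1/2 * \<Delta>t))) \<phi> =
      1 / \<Delta>t * J w \<phi>"
    by (simp_all only: scale)
  show "A_form \<Omega> (\<lambda>_. \<epsilon>\<^sup>2) (midpoint_fun u_n u) \<phi> = D u_n \<phi> + D w \<phi>"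
    unfolding mid using D_lincomb(1)[OF u_n wZ(1) assms(3), of 1 1] by simp
  show "L2_inner \<Omega> (\<lambda>x. h x * midpoint_fun U_n U x) \<phi> = J U_n \<phi> + J Z \<phi>"
    unfolding mid using J_lincomb(1)[OF U_n wZ(2) assms(3), of 1 1] by simp
qed

lemma solves_iff:
  "solves u U \<longleftrightarrow> u \<in> V \<and> U \<in> V \<and>
     (\<forall>\<phi>\<in>V. 2 / \<Delta>t * I (half_increment u_n u) \<phi> =
        - (D u_n \<phi> + D (half_increment u_n u) \<phi>) - (J U_n \<phi> + J (half_increment U_n U) \<phi>)) \<and>
     (\<forall>\<psi>\<in>V. 2 * I (half_increment U_n U) \<psi> = J (half_increment u_n u) \<psi>)"
proof -
  have cancel: "2 / \<Delta>t * a = 1 / \<Delta>t * b \<longleftrightarrow> 2 * a = b" for a b :: real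
    using dt by (simp add: field_simps)
  show ?thesis
    unfolding scheme_solution_def Let_def
    by (intro conj_cong ball_cong refl) (simp_all only: scheme_equations cancel)
qed

lemma forms_zero_right:
  assumes "w \<in> V" shows "I w 0 = 0" "D w 0 = 0" "J w 0 = 0"
proof -
  have zero: "0 \<in> V" using subspace_V by (rule subspace_0)
  show "I w 0 = 0" "D w 0 = 0" "J w 0 = 0"
    using I_lincomb(2)[OF zero zero assms, of 0 0] D_lincomb(2)[OF zero zero assms, of 0 0]
      J_lincomb(2)[OF zero zero assms, of 0 0]
    by (simp_all add: func_zero)
qed

text \<open>The two equations are recovered from their sum by testing with pairs in which one component
  vanishes.\<close>
lemma solves_iff_step_form:
  "solves u U \<longleftrightarrow> u \<in> V \<and> U \<in> V \<and>
     (\<forall>q\<in>V \<times> V. step_form (half_increment u_n u, half_increment U_n U) q = step_load q)"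
  (is "_ \<longleftrightarrow> _ \<and> _ \<and> ?weak")
proof (cases "u \<in> V \<and> U \<in> V")
  case True
  define w Z where "w = half_increment u_n u" and "Z = half_increment U_n U"
  have wZ: "w \<in> V" "Z \<in> V"
    unfolding w_def Z_def using True u_n U_n by (auto intro: half_increment_in_V)
  have zero: "0 \<in> V" using subspace_V by (rule subspace_0)
  have "?weak \<longleftrightarrow>
     (\<forall>\<phi>\<in>V. 2 / \<Delta>t * I w \<phi> = - (D u_n \<phi> + D w \<phi>) - (J U_n \<phi> + J Z \<phi>)) \<and>
     (\<forall>\<psi>\<in>V. 2 * I Z \<psi> = J w \<psi>)"
  proof (intro iffI conjI ballI)
    fix \<phi> assume weak: ?weak and \<phi>: "\<phi> \<in> V"
    from weak \<phi> zero have "step_form (w, Z) (\<phi>, 0) = step_load (\<phi>, 0)"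
      by (simp add: w_def Z_def)
    then show "2 / \<Delta>t * I w \<phi> = - (D u_n \<phi> + D w \<phi>) - (J U_n \<phi> + J Z \<phi>)"
      using wZ by (simp add: step_form_def step_load_def forms_zero_right)
    from weak \<phi> zero have "step_form (w, Z) (0, \<phi>) = step_load (0, \<phi>)"
      by (simp add: w_def Z_def)
    then show "2 * I Z \<phi> = J w \<phi>"
      using wZ u_n U_n by (simp add: step_form_def step_load_def forms_zero_right)
  next
    fix q assume "q \<in> V \<times> V" and
      "(\<forall>\<phi>\<in>V. 2 / \<Delta>t * I w \<phi> = - (D u_n \<phi> + D w \<phi>) - (J U_n \<phi> + J Z \<phi>)) \<and>
       (\<forall>\<psi>\<in>V. 2 * I Z \<psi> = J w \<psi>)"
    then show "step_form (half_increment u_n u, half_increment U_n U) q = step_load q"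
      unfolding w_def[symmetric] Z_def[symmetric] by (auto simp: step_form_def step_load_def)
  qed
  then show ?thesis using True by (simp add: solves_iff w_def Z_def)
qed (auto simp: solves_iff)

lemma half_increment_recover: "v = (\<lambda>x. 1 * v_n x + 2 * half_increment v_n v x)"
  by (simp add: half_increment_def fun_eq_iff)

lemma unique_solution: "\<exists>!(u, U). solves u U"
proof -
  define P where "P p \<longleftrightarrow> p \<in> V \<times> V \<and> (\<forall>q\<in>V \<times> V. step_form p q = step_load q)" for p
  have "\<exists>!p. P p" unfolding P_def by (rule step_form_unique_solution)
  then obtain p where p: "P p" and uniq': "\<And>p'. P p' \<Longrightarrow> p' = p" by blast
  obtain w Z where p_eq: "p = (w, Z)" by (cases p)
  note wZ = p[unfolded p_eq] and uniq = uniq'[unfolded p_eq]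
  define u U where "u = (\<lambda>x. 1 * u_n x + 2 * w x)" and "U = (\<lambda>x. 1 * U_n x + 2 * Z x)"
  have inc: "half_increment u_n u = w" "half_increment U_n U = Z"
    by (simp_all add: half_increment_def u_def U_def fun_eq_iff add_divide_distrib)
  have "w \<in> V" "Z \<in> V" using wZ by (auto simp: P_def)
  then have "u \<in> V" "U \<in> V"
    using lincomb[OF u_n, of w 1 2] lincomb[OF U_n, of Z 1 2] by (simp_all add: u_def U_def)
  then have solution: "solves u U" using wZ unfolding solves_iff_step_form inc P_def by blast
  have unique: "u' = u \<and> U' = U" if "solves u' U'" for u' U'
  proof -
    have "P (half_increment u_n u', half_increment U_n U')"
      using that u_n U_n unfolding solves_iff_step_form P_def
      by (blast intro: half_increment_in_V)
    from uniq[OF this]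
    have inc': "half_increment u_n u' = w" "half_increment U_n U' = Z" by simp_all
    have "u' = u" using half_increment_recover[of u' u_n] unfolding inc' u_def .
    moreover have "U' = U" using half_increment_recover[of U' U_n] unfolding inc' U_def .
    ultimately show ?thesis by simp
  qed
  show ?thesis
  proof (rule ex1I[of _ "(u, U)"])
    show "case (u, U) of (u, U) \<Rightarrow> solves u U" using solution by simp
    show "p' = (u, U)" if "case p' of (u, U) \<Rightarrow> solves u U" for p'
      using that unique[of "fst p'" "snd p'"] by (simp add: case_prod_beta prod_eq_iff)
  qed
qed

text \<open>Expanding at \<open>u = u\<^sub>n + 2 w\<close> and \<open>U = U\<^sub>n + 2 Z\<close>, the energy changes by
  \<open>2 A(\<epsilon>\<^sup>2; u\<^sub>n + w, w) + 4 (Z, U\<^sub>n + Z)\<close>. The first equation tested with \<open>w\<close> and the second with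
  \<open>U\<^sub>n + Z\<close> turn this into \<open>- 4/\<Delta>t (w, w)\<close>, as both contain the same term \<open>(h w, U\<^sub>n + Z)\<close>.\<close>
lemma energy_dissipation:
  assumes "solves u U"
  shows "energy \<Omega> \<epsilon> B u U =
    energy \<Omega> \<epsilon> B u_n U_n - 1 / \<Delta>t * (L2_norm \<Omega> (\<lambda>x. u x - u_n x))\<^sup>2"
proof -
  define w Z where "w = half_increment u_n u" and "Z = half_increment U_n U"
  have uU: "u \<in> V" "U \<in> V" using assms by (auto simp: solves_iff)
  then have V: "w \<in> V" "Z \<in> V" "u_n \<in> V" "U_n \<in> V"
    unfolding w_def Z_def using u_n U_n by (auto intro: half_increment_in_V)
  have eqs: "u = (\<lambda>x. 1 * u_n x + 2 * w x)" "U = (\<lambda>x. 1 * U_n x + 2 * Z x)"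
    by (auto simp: w_def Z_def half_increment_def fun_eq_iff)
  have energy: "energy \<Omega> \<epsilon> B v W = 1/2 * D v v + I W W - B * measure lebesgue \<Omega>" for v W
    by (simp add: energy_def L2_inner_def power2_eq_square)
  have first: "2 / \<Delta>t * I w w = - (D u_n w + D w w) - (J U_n w + J Z w)"
    using assms V(1) unfolding solves_iff w_def Z_def by blast
  have mid: "(\<lambda>x. 1 * U_n x + 1 * Z x) \<in> V" using V by (intro lincomb)
  have "2 * I Z (\<lambda>x. 1 * U_n x + 1 * Z x) = J w (\<lambda>x. 1 * U_n x + 1 * Z x)"
    using assms mid unfolding solves_iff w_def Z_def by blast
  then have second: "2 * (I Z U_n + I Z Z) = J w U_n + J w Z"
    unfolding I_lincomb(2)[OF V(4,2,2)] J_lincomb(2)[OF V(4,2,1)] by simp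
  have "D u u = D u_n u_n + 4 * D u_n w + 4 * D w w"
  proof -
    have "D u u = D u_n u + 2 * D w u"
      using D_lincomb(1)[OF V(3,1) uU(1), of 1 2, folded eqs(1)] by simp
    moreover have "D v u = D v u_n + 2 * D v w" if "v \<in> V" for v
      using D_lincomb(2)[OF V(3,1) that, of 1 2, folded eqs(1)] by simp
    ultimately show ?thesis using V by (simp add: A_form_commute[of _ _ w u_n])
  qed
  moreover have "I U U = I U_n U_n + 4 * I Z U_n + 4 * I Z Z"
  proof -
    have "I U U = I U_n U + 2 * I Z U"
      using I_lincomb(1)[OF V(4,2) uU(2), of 1 2, folded eqs(2)] by simp
    moreover have "I v U = I v U_n + 2 * I v Z" if "v \<in> V" for v
      using I_lincomb(2)[OF V(4,2) that, of 1 2, folded eqs(2)] by simp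
    ultimately show ?thesis using V by (simp add: L2_inner_commute[of U_n Z])
  qed
  moreover have norm: "(L2_norm \<Omega> (\<lambda>x. u x - u_n x))\<^sup>2 = 4 * I w w"
  proof -
    have "(u x - u_n x) * (u x - u_n x) = 4 * (w x * w x)" for x
      by (simp add: w_def half_increment_def field_simps)
    then have "I (\<lambda>x. u x - u_n x) (\<lambda>x. u x - u_n x) = 4 * I w w"
      by (simp only: L2_inner_def set_integral_mult_right)
    then show ?thesis using L2_inner_nonneg[of w] by (simp add: L2_norm_def)
  qed
  moreover have "J U_n w = J w U_n" "J Z w = J w Z" by (rule J_commute)+
  ultimately have "1/2 * D u u + I U U = 1/2 * D u_n u_n + I U_n U_n - 2 * (2 / \<Delta>t * I w w)"
    unfolding first using second by (simp add: add_divide_distrib)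
  then have "energy \<Omega> \<epsilon> B u U = energy \<Omega> \<epsilon> B u_n U_n - 2 * (2 / \<Delta>t * I w w)"
    unfolding energy by simp
  then show ?thesis unfolding norm by simp
qed

end

section \<open>Well-posedness and energy dissipation of the scheme\<close>
lemma continuous_on_H_fun:
  assumes F: "C1_potential I F F'" and f: "continuous_on S f"
    and range: "\<And>x. x \<in> S \<Longrightarrow> f x \<in> I \<and> F (f x) + B > 0"
  shows "continuous_on S (\<lambda>x. H_fun F F' B (f x))"
proof -
  have sub: "f ` S \<subseteq> I" using range by blast
  have "continuous_on I F"
    by (rule DERIV_continuous_on[of I F F']) (use F in \<open>simp add: C1_potential_def\<close>)
  from continuous_on_compose2[OF this f sub] have "continuous_on S (\<lambda>x. F (f x))" .
  moreover have "continuous_on I F'" using F by (simp add: C1_potential_def)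
  from continuous_on_compose2[OF this f sub] have "continuous_on S (\<lambda>x. F' (f x))" .
  moreover have "sqrt (F (f x) + B) \<noteq> 0" if "x \<in> S" for x using range[OF that] by simp
  ultimately show ?thesis
    unfolding H_fun_def
    by (intro continuous_on_divide continuous_on_real_sqrt continuous_on_add continuous_on_const) auto
qed

theorem lemmaB1:
  fixes \<Omega> :: "'a::euclidean_space set" and \<T> :: "'a set set" and k :: nat
    and \<rho> \<epsilon> B \<Delta>t :: real and I :: "real set" and F F' :: "real \<Rightarrow> real"
    and u_prev u_n U_n :: "'a \<Rightarrow> real"
  assumes dim: "DIM('a) = 2 \<or> DIM('a) = 3"
    and dom: "domain \<Omega>" "bounded \<Omega>"
    and mesh: "triangulation_of \<Omega> \<T>" "quasi_uniform \<rho> \<T>"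
    and k: "k \<ge> 1"
    and eps: "\<epsilon> > 0"
    and F: "C1_potential I F F'"
    and B: "B \<ge> 0"
    and data: "u_prev \<in> fe_space \<Omega> \<T> k" "u_n \<in> fe_space \<Omega> \<T> k" "U_n \<in> fe_space \<Omega> \<T> k"
    and range: "\<And>x. x \<in> closure \<Omega> \<Longrightarrow>
      extrapolation u_prev u_n x \<in> I \<and> F (extrapolation u_prev u_n x) + B > 0"
    and dt: "\<Delta>t > 0"
  shows "(\<exists>!(u, U). scheme_solution (fe_space \<Omega> \<T> k) \<Omega> \<epsilon> \<Delta>t
              (\<lambda>x. H_fun F F' B (extrapolation u_prev u_n x)) u_n U_n u U) \<and>
         (\<forall>u U. scheme_solution (fe_space \<Omega> \<T> k) \<Omega> \<epsilon> \<Delta>t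
              (\<lambda>x. H_fun F F' B (extrapolation u_prev u_n x)) u_n U_n u U \<longrightarrow>
            energy \<Omega> \<epsilon> B u U =
            energy \<Omega> \<epsilon> B u_n U_n - 1 / \<Delta>t * (L2_norm \<Omega> (\<lambda>x. u x - u_n x))\<^sup>2)"
proof -
  have "open \<Omega>" using dom(1) by (simp add: domain_def)
  have mesh': "finite \<T>" "closure \<Omega> \<subseteq> \<Union>\<T>"
    using mesh(1) by (auto simp: triangulation_of_def triangulation_def)
  interpret conforming_space \<Omega> "fe_space \<Omega> \<T> k"
  proof
    show "\<exists>S. finite S \<and> fe_space \<Omega> \<T> k \<subseteq> span S"
      using fe_space_finite_dimensional[OF mesh'] .
    show "subspace (fe_space \<Omega> \<T> k)"
      using subspace_fe_space[OF \<open>open \<Omega>\<close> dom(2)] .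
  qed (use \<open>open \<Omega>\<close> dom(2) in \<open>auto simp: fe_space_def\<close>)
  have "extrapolation u_prev u_n \<in> fe_space \<Omega> \<T> k"
    using lincomb[OF data(2,1), of "3/2" "-1/2"] by (simp add: extrapolation_def)
  from continuous_on_H_fun[OF F cont[OF this] range]
  interpret crank_nicolson_step \<Omega> "fe_space \<Omega> \<T> k"
    "\<lambda>x. H_fun F F' B (extrapolation u_prev u_n x)" \<epsilon> \<Delta>t u_n U_n
    using dt data by unfold_locales auto
  show ?thesis using unique_solution energy_dissipation by blast
qed

end
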